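(* Let $n\ge3$ and $1\le d\le n-1$ be integers. There exist constants $C_n,c_n>0$ depending only on $n$ and: a threshold $\delta_0>0$ depending only on $n$; for each $0<\delta<\delta_0$ a threshold $\epsilon_0>0$ depending only on $n,\delta$; and for each such $\delta$ and each $0<\epsilon<\epsilon_0$ a threshold $Q_0$ depending only on $n,\delta,\epsilon$, such that the following holds. For all $\phi\in C^2([0,1]^d;\mathbb R^{n-d})$, all $0<\delta<\delta_0$, all $0<\epsilon<\epsilon_0$ and all real $Q\ge Q_0$, there exist $g\in \mathrm{SL}_n(\mathbb R)$ with $\max_{i,j}|g_{ij}-\delta_{ij}|<2\delta$ (where $\delta_{ij}$ is the Kronecker delta) and $\phi_g\in C^2([0,1]^d;\mathbb R^{n-d})$ with $\|\phi-\phi_g\|_{C^2}\le C_n\epsilon$ for which $$\bigl|g\mathcal M_{\phi_g}\cap Q^{-1}\mathbb Z^n_{\mathrm{prim}}\bigr|\ \ge\ c_n\,\delta^{n^2-1}\epsilon^{n-d}\,Q^{\frac{dn}{d+2(n-d)}}.$$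
   Context: For $\phi\in C^2([0,1]^d;\mathbb R^{n-d})$, $\mathcal M_\phi=\{(\xi,\phi(\xi)):\xi\in[0,1]^d\}\subset\mathbb R^n$ is its graph, and $g\mathcal M_\phi$ is the image under the linear map $g$. $\mathbb Z^n_{\mathrm{prim}}$ is the set of primitive vectors of $\mathbb Z^n$ (nonzero integer vectors whose coordinates have gcd $1$), and $Q^{-1}\mathbb Z^n_{\mathrm{prim}}$ is its dilate by $1/Q$. $|\cdot|$ of a set denotes cardinality. The norm is $\|\phi\|_{C^2}=\max_{0\le|\alpha|\le2}\sup_{x\in[0,1]^d}|D^\alpha\phi(x)|$. *)

theory Defs
  imports "HOL-Analysis.Derivative" "HOL-Analysis.L2_Norm" "Jordan_Normal_Form.Determinant"
begin

text \<open>
  The dimensions are ordinary natural numbers, because constants have to be chosen between the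
  quantifiers over \<open>n\<close> and over \<open>d\<close>. Points of \<open>\<real>\<^sup>n\<close> and \<open>n \<times> n\<close> matrices are the vectors and
  matrices of \<open>Jordan_Normal_Form\<close>. The domain \<open>[0,1]\<^sup>d\<close> consists of extensional functions
  \<open>nat \<Rightarrow> real\<close>, so that the library's product topology on \<open>nat \<Rightarrow> real\<close> induces on it the Euclidean
  topology. A map \<open>[0,1]\<^sup>d \<rightarrow> \<real>\<^sup>m\<close> is a function \<open>\<phi>\<close> of which only the components \<open>\<phi> x j\<close> with
  \<open>x\<close> in the cube and \<open>j < m\<close> matter.
\<close>

definition unit_cube :: "nat \<Rightarrow> (nat \<Rightarrow> real) set" where
  "unit_cube d = {..<d} \<rightarrow>\<^sub>E {0..1}"

text \<open>Partial derivatives are one-sided on the faces of the cube.\<close>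

definition partial_deriv :: "nat \<Rightarrow> ((nat \<Rightarrow> real) \<Rightarrow> real) \<Rightarrow> (nat \<Rightarrow> real) \<Rightarrow> real" where
  "partial_deriv i f x = vector_derivative (\<lambda>t. f (x(i := t))) (at (x i) within {0..1})"

primrec Ck_cube :: "nat \<Rightarrow> nat \<Rightarrow> ((nat \<Rightarrow> real) \<Rightarrow> real) \<Rightarrow> bool" where
  "Ck_cube d 0 f \<longleftrightarrow> continuous_on (unit_cube d) f"
| "Ck_cube d (Suc k) f \<longleftrightarrow> continuous_on (unit_cube d) f \<and>
     (\<forall>i<d. (\<forall>x\<in>unit_cube d. (\<lambda>t. f (x(i := t))) differentiable (at (x i) within {0..1})) \<and>
            Ck_cube d k (partial_deriv i f))"

definition C2_maps :: "nat \<Rightarrow> nat \<Rightarrow> ((nat \<Rightarrow> real) \<Rightarrow> nat \<Rightarrow> real) set" where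
  "C2_maps d m = {\<phi>. \<forall>j<m. Ck_cube d 2 (\<lambda>x. \<phi> x j)}"

definition multi_indices :: "nat \<Rightarrow> nat \<Rightarrow> (nat \<Rightarrow> nat) set" where
  "multi_indices d k = {\<alpha>. (\<forall>i\<ge>d. \<alpha> i = 0) \<and> (\<Sum>i<d. \<alpha> i) \<le> k}"

definition multi_deriv :: "nat \<Rightarrow> (nat \<Rightarrow> nat) \<Rightarrow> ((nat \<Rightarrow> real) \<Rightarrow> real) \<Rightarrow> (nat \<Rightarrow> real) \<Rightarrow> real" where
  "multi_deriv d \<alpha> f = foldr (\<lambda>i. partial_deriv i ^^ \<alpha> i) [0..<d] f"

definition C2_norm :: "nat \<Rightarrow> nat \<Rightarrow> ((nat \<Rightarrow> real) \<Rightarrow> nat \<Rightarrow> real) \<Rightarrow> real" where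
  "C2_norm d m \<phi> = (MAX \<alpha>\<in>multi_indices d 2. SUP x\<in>unit_cube d.
      L2_set (\<lambda>j. multi_deriv d \<alpha> (\<lambda>y. \<phi> y j) x) {..<m})"

definition graph_manifold :: "nat \<Rightarrow> nat \<Rightarrow> ((nat \<Rightarrow> real) \<Rightarrow> nat \<Rightarrow> real) \<Rightarrow> real vec set" where
  "graph_manifold d m \<phi> = (\<lambda>\<xi>. vec d \<xi> @\<^sub>v vec m (\<phi> \<xi>)) ` unit_cube d"

definition special_linear :: "nat \<Rightarrow> real mat set" where
  "special_linear n = {g \<in> carrier_mat n n. det g = 1}"

definition primitive_vecs :: "nat \<Rightarrow> int vec set" where
  "primitive_vecs n = {v \<in> carrier_vec n. v \<noteq> 0\<^sub>v n \<and> Gcd (set\<^sub>v v) = 1}"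

definition scaled_primitive_vecs :: "real \<Rightarrow> nat \<Rightarrow> real vec set" where
  "scaled_primitive_vecs Q n = (\<lambda>v. (1 / Q) \<cdot>\<^sub>v map_vec real_of_int v) ` primitive_vecs n"

end

theory Submission
  imports Defs
begin

text \<open>
  Write \<open>m = n - d\<close>. Divide \<open>[0,1]\<^sup>d\<close> into cells of side \<open>1 / K\<close>, where \<open>K\<close> is
  about \<open>Q powr (n / (d + 2 m))\<close>, so that there are about \<open>K ^ d = Q powr (d n / (d + 2 m))\<close> cells.
  Inside one cell, adding to \<open>\<phi>\<close> a bump of height about \<open>\<epsilon> / K\<^sup>2\<close> changes the \<open>C\<^sup>2\<close> norm by
  \<open>O(\<epsilon>)\<close> only. Hence the graph can be made to pass through any prescribed point \<open>(\<xi>, y)\<close> with \<open>\<xi>\<close> in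
  the middle half of the cell and \<open>y\<close> at distance at most \<open>\<epsilon> / K\<^sup>2\<close> from \<open>\<phi> \<xi>\<close> (lemma
  \<open>graph_through_hits\<close>). It remains to find \<open>g\<close> near the identity such that for a proportion of at
  least a constant times \<open>\<epsilon> ^ m\<close> of the cells such a point lies in \<open>g\<^sup>-\<^sup>1 Q\<^sup>-\<^sup>1 \<int>\<^sup>n\<close> and comes from a
  primitive vector.

  It suffices to take for \<open>g\<close> a shear \<open>(\<xi>, y) \<mapsto> (\<xi>, y - \<beta> \<xi>)\<close>, where the entries of the \<open>m \<times> d\<close> matrix
  \<open>\<beta>\<close> are chosen at random from a fine grid in \<open>[0, \<delta>)\<close>. With \<open>\<xi> = \<alpha> / Q\<close> for an integer vector
  \<open>\<alpha>\<close> and \<open>\<eta> = \<epsilon> Q / K\<^sup>2\<close>, the condition becomes that for each row \<open>\<beta>\<^sub>j\<close> the number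
  \<open>Q \<phi>\<^sub>j (\<alpha> / Q) - \<beta>\<^sub>j \<cdot> \<alpha>\<close> lies within \<open>\<eta>\<close> of an integer \<open>z\<^sub>j\<close>. The vector \<open>(\<alpha>, z)\<close> is primitive
  if \<open>z\<^sub>0\<close> is coprime to \<open>\<alpha>\<^sub>0\<close>. Since \<open>\<phi>\<close> enters only through translations, all estimates are
  uniform in \<open>\<phi>\<close>. The number of hits in a cell is controlled by two moments.

  First moment: \<open>\<beta>\<^sub>j\<^sub>0 \<alpha>\<^sub>0\<close> sweeps an interval of length about \<open>\<delta> Q\<close>, so each row condition has
  probability at least a constant times \<open>\<eta>\<close>; the coprimality condition costs a constant factor on average
  over \<open>\<alpha>\<^sub>0\<close> (\<open>card_coprime_pairs_ge\<close>). The expected number of hits in a cell is therefore at least a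
  constant times \<open>(Q / K) ^ d * \<eta> ^ m\<close>, which is about \<open>\<epsilon> ^ m\<close> by the choice of \<open>K\<close>
  (\<open>first_moment_ge\<close>).

  Second moment: for distinct \<open>\<alpha>, \<alpha>'\<close> in one cell both conditions on a row hold with probability
  at most a constant times \<open>\<eta>\<^sup>2 / \<delta>\<close> (\<open>card_row_pair_le\<close>). If \<open>\<alpha>\<^sub>0 = \<alpha>'\<^sub>0\<close>, some other coordinate
  differs and the two conditions are controlled by two different entries of the row. If
  \<open>\<alpha>\<^sub>0 \<noteq> \<alpha>'\<^sub>0\<close>, the entry \<open>\<beta>\<^sub>j\<^sub>0\<close> alone suffices: the difference of the conditions confines it to
  intervals of length about \<open>\<eta> / \<bar>\<alpha>\<^sub>0 - \<alpha>'\<^sub>0\<bar>\<close>, and on each of them \<open>\<beta>\<^sub>j\<^sub>0 \<alpha>\<^sub>0\<close> still passes about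
  \<open>\<eta> \<alpha>\<^sub>0 / \<bar>\<alpha>\<^sub>0 - \<alpha>'\<^sub>0\<bar>\<close> integers; this quantity is at least \<open>\<eta> K = \<epsilon> Q / K\<close>, which is large.

  The expected number of pairs of hits in a cell is thus \<open>O(\<epsilon>\<^sup>2\<^sup>m)\<close> with a constant depending on \<open>\<delta>\<close> and \<open>n\<close>,
  and it is negligible against the first moment when \<open>\<epsilon>\<close> is small in terms of \<open>\<delta>\<close>. So a cell is hit
  with probability at least a constant times \<open>\<epsilon> ^ m\<close>, and some shear hits at least the expected number
  of cells. The factor \<open>\<delta> ^ (n\<^sup>2 - 1) \<le> 1\<close> is not needed for this choice of \<open>g\<close>.
\<close>

section \<open>Counting integers in intervals\<close>

lemma finite_int_between: "finite {b::int. u \<le> real_of_int b \<and> real_of_int b \<le> v}"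
proof -
  have "{b::int. u \<le> real_of_int b \<and> real_of_int b \<le> v} = {\<lceil>u\<rceil>..\<lfloor>v\<rfloor>}"
    by (auto simp: ceiling_le_iff le_floor_iff)
  then show ?thesis by simp
qed

lemma card_int_between_le:
  assumes "u \<le> v + 1"
  shows "real (card {b::int. u \<le> real_of_int b \<and> real_of_int b \<le> v}) \<le> v - u + 1"
proof -
  have "{b::int. u \<le> real_of_int b \<and> real_of_int b \<le> v} = {\<lceil>u\<rceil>..\<lfloor>v\<rfloor>}"
    by (auto simp: ceiling_le_iff le_floor_iff)
  then have "real (card {b::int. u \<le> real_of_int b \<and> real_of_int b \<le> v}) = real (nat (\<lfloor>v\<rfloor> - \<lceil>u\<rceil> + 1))"
    by simp
  also have "\<dots> \<le> v - u + 1" using assms by linarith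
  finally show ?thesis .
qed

lemma card_int_between_ge:
  "real (card {b::int. u \<le> real_of_int b \<and> real_of_int b \<le> v}) \<ge> v - u - 1"
proof -
  have "{b::int. u \<le> real_of_int b \<and> real_of_int b \<le> v} = {\<lceil>u\<rceil>..\<lfloor>v\<rfloor>}"
    by (auto simp: ceiling_le_iff le_floor_iff)
  then have "real (card {b::int. u \<le> real_of_int b \<and> real_of_int b \<le> v}) = real (nat (\<lfloor>v\<rfloor> - \<lceil>u\<rceil> + 1))"
    by simp
  also have "\<dots> \<ge> v - u - 1" by linarith
  finally show ?thesis .
qed

text \<open>\<open>x\<close> is at distance at most \<open>\<eta>\<close> from an element of \<open>W\<close>. The set \<open>W\<close> is either the set of all
  integers or that of the integers coprime to a given one.\<close>

definition near :: "int set \<Rightarrow> real \<Rightarrow> real \<Rightarrow> bool" where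
  "near W \<eta> x \<longleftrightarrow> (\<exists>z\<in>W. \<bar>x - real_of_int z\<bar> \<le> \<eta>)"

lemma near_mono: "near W \<eta> x \<Longrightarrow> W \<subseteq> W' \<Longrightarrow> near W' \<eta> x"
  by (auto simp: near_def)

lemma near_uminus: "near UNIV \<eta> (- x) \<longleftrightarrow> near UNIV \<eta> x"
proof -
  have "near UNIV \<eta> (- x)" if h: "near UNIV \<eta> x" for x
  proof -
    obtain z where "\<bar>x - real_of_int z\<bar> \<le> \<eta>" using h by (auto simp: near_def)
    then have "\<bar>- x - real_of_int (- z)\<bar> \<le> \<eta>" by simp
    then show ?thesis unfolding near_def by blast
  qed
  from this[of x] this[of "- x"] show ?thesis by auto
qed

lemma near_diff:
  assumes "near UNIV \<eta> x" "near UNIV \<eta> y"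
  shows "near UNIV (2 * \<eta>) (x - y)"
proof -
  obtain z where z: "\<bar>x - real_of_int z\<bar> \<le> \<eta>" using assms by (auto simp: near_def)
  obtain w where w: "\<bar>y - real_of_int w\<bar> \<le> \<eta>" using assms by (auto simp: near_def)
  have "\<bar>(x - y) - real_of_int (z - w)\<bar> \<le> 2 * \<eta>" using z w by simp
  then show ?thesis unfolding near_def by blast
qed

lemma near_one_integer_iff:
  fixes \<theta> k \<eta> b z :: real
  assumes "k > 0"
  shows "\<bar>\<theta> - k * b - z\<bar> \<le> \<eta> \<longleftrightarrow> (\<theta> - z - \<eta>) / k \<le> b \<and> b \<le> (\<theta> - z + \<eta>) / k"
proof -
  have "(\<theta> - z - \<eta>) / k \<le> b \<longleftrightarrow> \<theta> - z - \<eta> \<le> b * k" by (rule pos_divide_le_eq[OF assms])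
  moreover have "b \<le> (\<theta> - z + \<eta>) / k \<longleftrightarrow> b * k \<le> \<theta> - z + \<eta>" by (rule pos_le_divide_eq[OF assms])
  ultimately show ?thesis unfolding abs_le_iff mult.commute[of b k] by linarith
qed

text \<open>As \<open>b\<close> runs over an interval of length \<open>l\<close>, the linear function \<open>\<theta> - k b\<close> passes near at most
  \<open>k l + 2 \<eta> + 1\<close> integers, and each passage takes up an interval of length \<open>2 \<eta> / k\<close>. A bound
  \<open>M\<close> for the number of suitable \<open>b\<close> in intervals of that length can therefore be fed in.\<close>

lemma card_near_passages_le:
  fixes \<theta> k \<eta> l x0 M :: real and R :: "int \<Rightarrow> bool"
  assumes "k > 0" "\<eta> \<ge> 0" "l \<ge> 0"
    and M: "\<And>u. real (card {b. u \<le> real_of_int b \<and> real_of_int b \<le> u + 2 * \<eta> / k \<and> R b}) \<le> M"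
  shows "real (card {b. x0 \<le> real_of_int b \<and> real_of_int b \<le> x0 + l \<and> R b \<and>
                        near UNIV \<eta> (\<theta> - k * real_of_int b)}) \<le> (k * l + 2 * \<eta> + 1) * M"
proof -
  define Z where "Z = {z::int. \<theta> - k * (x0 + l) - \<eta> \<le> real_of_int z \<and> real_of_int z \<le> \<theta> - k * x0 + \<eta>}"
  define u where "u z = (\<theta> - real_of_int z - \<eta>) / k" for z :: int
  define T where "T z = {b. u z \<le> real_of_int b \<and> real_of_int b \<le> u z + 2 * \<eta> / k \<and> R b}" for z
  have finZ: "finite Z" unfolding Z_def by (rule finite_int_between)
  have finT: "finite (T z)" for z
    unfolding T_def by (rule finite_subset[OF _ finite_int_between[of "u z" "u z + 2 * \<eta> / k"]]) auto
  have "{b. x0 \<le> real_of_int b \<and> real_of_int b \<le> x0 + l \<and> R b \<and>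
            near UNIV \<eta> (\<theta> - k * real_of_int b)} \<subseteq> (\<Union>z\<in>Z. T z)" (is "?S \<subseteq> _")
  proof
    fix b assume "b \<in> ?S"
    then have b: "x0 \<le> real_of_int b" "real_of_int b \<le> x0 + l" "R b"
      and "near UNIV \<eta> (\<theta> - k * real_of_int b)" by auto
    then obtain z where z: "\<bar>\<theta> - k * real_of_int b - real_of_int z\<bar> \<le> \<eta>" by (auto simp: near_def)
    have "k * x0 \<le> k * real_of_int b" "k * real_of_int b \<le> k * (x0 + l)"
      using b \<open>k > 0\<close> by (auto intro!: mult_left_mono)
    then have "z \<in> Z" using z by (auto simp: Z_def abs_le_iff)
    moreover have "b \<in> T z"
    proof -
      have "u z + 2 * \<eta> / k = (\<theta> - real_of_int z + \<eta>) / k"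
        unfolding u_def add_divide_distrib[symmetric] by simp
      then show ?thesis using z b near_one_integer_iff[OF \<open>k > 0\<close>, of \<theta> b z \<eta>]
        unfolding T_def by (simp add: u_def)
    qed
    ultimately show "b \<in> (\<Union>z\<in>Z. T z)" by blast
  qed
  then have "card ?S \<le> card (\<Union>z\<in>Z. T z)" using finZ finT by (intro card_mono) auto
  also have "\<dots> \<le> (\<Sum>z\<in>Z. card (T z))" by (rule card_UN_le[OF finZ])
  finally have "real (card ?S) \<le> (\<Sum>z\<in>Z. real (card (T z)))"
    unfolding of_nat_sum[symmetric] of_nat_le_iff .
  also have "\<dots> \<le> (\<Sum>z\<in>Z. M)" by (intro sum_mono) (auto simp: T_def intro: M)
  also have "\<dots> = real (card Z) * M" by simp
  also have "\<dots> \<le> (k * l + 2 * \<eta> + 1) * M"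
  proof (rule mult_right_mono)
    have "real (card Z) \<le> (\<theta> - k * x0 + \<eta>) - (\<theta> - k * (x0 + l) - \<eta>) + 1"
      unfolding Z_def using assms by (intro card_int_between_le) (auto simp: algebra_simps)
    then show "real (card Z) \<le> k * l + 2 * \<eta> + 1" by (simp add: algebra_simps)
    show "M \<ge> 0" using M[of 0] by (rule order_trans[rotated]) simp
  qed
  finally show ?thesis .
qed

lemma card_near_le:
  fixes \<theta> k \<eta> l x0 :: real
  assumes "k > 0" "\<eta> \<ge> 0" "l \<ge> 0"
  shows "real (card {b::int. x0 \<le> real_of_int b \<and> real_of_int b \<le> x0 + l \<and>
                        near UNIV \<eta> (\<theta> - k * real_of_int b)}) \<le> (k * l + 2 * \<eta> + 1) * (2 * \<eta> / k + 1)"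
  using card_near_passages_le[of k \<eta> l "\<lambda>_. True" "2 * \<eta> / k + 1" x0 \<theta>] assms
    card_int_between_le[of u "u + 2 * \<eta> / k" for u]
  by force

lemma card_near_near_le:
  fixes \<theta> k \<eta> l x0 \<theta>' k' \<eta>' :: real
  assumes "k > 0" "\<eta> \<ge> 0" "l \<ge> 0" "k' > 0" "\<eta>' \<ge> 0"
  shows "real (card {b::int. x0 \<le> real_of_int b \<and> real_of_int b \<le> x0 + l \<and>
            near UNIV \<eta> (\<theta> - k * real_of_int b) \<and> near UNIV \<eta>' (\<theta>' - k' * real_of_int b)})
     \<le> (k' * l + 2 * \<eta>' + 1) * ((k * (2 * \<eta>' / k') + 2 * \<eta> + 1) * (2 * \<eta> / k + 1))"
  using card_near_passages_le[of k' \<eta>' l "\<lambda>b. near UNIV \<eta> (\<theta> - k * real_of_int b)"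
      "(k * (2 * \<eta>' / k') + 2 * \<eta> + 1) * (2 * \<eta> / k + 1)" x0 \<theta>']
    card_near_le[of k \<eta> "2 * \<eta>' / k'"] assms
  by force

text \<open>Passages near different integers are disjoint when \<open>\<eta> < 1/2\<close>.\<close>

lemma card_near_ge:
  fixes \<theta> k \<eta> x1 x2 :: real and J W :: "int set"
  assumes "k > 0" "\<eta> < 1 / 2" "finite J"
    and J: "\<And>z. z \<in> J \<Longrightarrow> z \<in> W \<and> k * x1 \<le> \<theta> - z - \<eta> \<and> \<theta> - z + \<eta> \<le> k * x2"
  shows "real (card {b::int. x1 \<le> real_of_int b \<and> real_of_int b \<le> x2 \<and>
            near W \<eta> (\<theta> - k * real_of_int b)}) \<ge> real (card J) * (2 * \<eta> / k - 1)" (is "real (card ?S) \<ge> _")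
proof -
  define T where "T z = {b::int. (\<theta> - real_of_int z - \<eta>) / k \<le> real_of_int b \<and>
                        real_of_int b \<le> (\<theta> - real_of_int z + \<eta>) / k}" for z :: int
  have finT: "finite (T z)" for z unfolding T_def by (rule finite_int_between)
  have T: "b \<in> T z \<longleftrightarrow> \<bar>\<theta> - k * real_of_int b - real_of_int z\<bar> \<le> \<eta>" for b z
    unfolding T_def near_one_integer_iff[OF \<open>k > 0\<close>] by simp
  have "(\<Sum>z\<in>J. real (card (T z))) = real (card (\<Union>z\<in>J. T z))"
  proof -
    have "T z \<inter> T z' = {}" if "z \<noteq> z'" for z z'
    proof -
      have "1 \<le> \<bar>real_of_int z - real_of_int z'\<bar>" using that by linarith
      then show ?thesis using \<open>\<eta> < 1/2\<close> by (auto simp: T)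
    qed
    then show ?thesis by (subst card_UN_disjoint) (use finT assms in auto)
  qed
  also have "\<dots> \<le> real (card ?S)"
  proof -
    have "b \<in> ?S" if "z \<in> J" "b \<in> T z" for z b
    proof -
      have b: "\<bar>\<theta> - k * real_of_int b - real_of_int z\<bar> \<le> \<eta>" using that T by blast
      have "k * x1 \<le> k * b" "k * b \<le> k * x2" using b J[OF \<open>z \<in> J\<close>] by (auto simp: abs_le_iff)
      then show ?thesis using \<open>k > 0\<close> b J[OF \<open>z \<in> J\<close>] by (auto simp: near_def)
    qed
    then have "(\<Union>z\<in>J. T z) \<subseteq> ?S" by blast
    moreover have "finite ?S" by (rule finite_subset[OF _ finite_int_between[of x1 x2]]) auto
    ultimately show ?thesis by (simp add: card_mono)
  qed
  finally have "(\<Sum>z\<in>J. real (card (T z))) \<le> real (card ?S)" .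
  moreover have "(\<Sum>z\<in>J. 2 * \<eta> / k - 1) \<le> (\<Sum>z\<in>J. real (card (T z)))"
  proof (rule sum_mono)
    fix z
    show "2 * \<eta> / k - 1 \<le> real (card (T z))"
      using card_int_between_ge[of "(\<theta> - real_of_int z + \<eta>) / k" "(\<theta> - real_of_int z - \<eta>) / k"] \<open>k > 0\<close>
        card_int_between_ge[of "(\<theta> - real_of_int z - \<eta>) / k" "(\<theta> - real_of_int z + \<eta>) / k"]
      unfolding T_def by (simp add: field_simps)
  qed
  ultimately show ?thesis by simp
qed

section \<open>Coprime pairs in short intervals\<close>

lemma card_multiples_le:
  fixes k :: int
  assumes "k \<ge> 1"
  shows "real (card {b\<in>{c+1..c + int L}. k dvd b}) \<le> real L / k + 1"
proof -
  have "{b\<in>{c+1..c + int L}. k dvd b} \<subseteq>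
      (\<lambda>j. k * j) ` {j. (c + 1) / k \<le> real_of_int j \<and> real_of_int j \<le> (c + int L) / k}" (is "?S \<subseteq> ?f ` ?T")
  proof
    fix b assume b: "b \<in> ?S"
    then obtain j where j: "b = k * j" by auto
    have "real_of_int (c + 1) \<le> real_of_int k * real_of_int j"
         "real_of_int k * real_of_int j \<le> real_of_int (c + int L)"
      using b j by (simp_all flip: of_int_mult of_int_add)
    then show "b \<in> ?f ` ?T" using j assms by (auto simp: field_simps)
  qed
  then have "card ?S \<le> card ?T"
    using finite_int_between by (meson surj_card_le)
  moreover have "real (card ?T) \<le> (c + int L) / k - (c + 1) / k + 1"
  proof (rule card_int_between_le)
    have "real_of_int k * 1 \<le> real_of_int k * (real_of_int k + real L)"
      using assms by (intro mult_left_mono) auto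
    then show "(c + 1) / k \<le> (c + int L) / k + 1" using assms by (simp add: field_simps)
  qed
  moreover have "(c + int L) / k - (c + 1) / k + 1 \<le> real L / k + 1"
    using assms by (simp add: field_simps)
  ultimately show ?thesis by linarith
qed

lemma sum_inverse_squares_le:
  "(\<Sum>k = 2..M. 1 / (real k)\<^sup>2) \<le> 3 / 4"
proof -
  have "(\<Sum>k = 2..M. 1 / (real k)\<^sup>2) \<le> 3 / 4 - 1 / real M" if "M \<ge> 2" for M
    using that
  proof (induction M rule: dec_induct)
    case base show ?case by simp
  next
    case (step M)
    have "1 / (real (Suc M))\<^sup>2 \<le> 1 / real M - 1 / real (Suc M)"
    proof -
      have "1 / (real (Suc M))\<^sup>2 \<le> 1 / (real M * real (Suc M))"
        using step.hyps by (intro divide_left_mono) (auto simp: power2_eq_square)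
      also have "\<dots> = 1 / real M - 1 / real (Suc M)" using step.hyps by (simp add: field_simps)
      finally show ?thesis .
    qed
    then show ?case using step by simp
  qed
  note bound = this
  show ?thesis
  proof (cases "M \<ge> 2")
    case True
    have "3 / 4 - 1 / real M \<le> 3 / 4" by simp
    with bound[OF True] show ?thesis by (rule order_trans)
  qed simp
qed

lemma sum_inverse_le_ln: "M \<ge> 1 \<Longrightarrow> (\<Sum>k = 2..M. 1 / real k) \<le> ln (real M)"
proof (induction M rule: dec_induct)
  case base show ?case by simp
next
  case (step M)
  have "ln (real M / real (Suc M)) \<le> real M / real (Suc M) - 1"
    using step.hyps by (intro ln_le_minus_one) auto
  then have "1 / real (Suc M) \<le> ln (real (Suc M)) - ln (real M)"
    using step.hyps by (simp add: ln_div field_simps)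
  then show ?case using step by simp
qed

text \<open>Among the pairs \<open>(a, z)\<close> with \<open>a\<close> in one interval and \<open>z\<close> in an interval of fixed length that may
  depend on \<open>a\<close>, the pairs with a common divisor \<open>k \<ge> 2\<close> make up a proportion of at most
  the sum of \<open>1 / k\<^sup>2\<close> over \<open>k \<ge> 2\<close>, which is less than \<open>3 / 4\<close>, up to an error that is small once both intervals are much longer than the
  logarithm of the upper bound \<open>Q\<close> for \<open>a\<close>.\<close>

lemma card_coprime_pairs_ge:
  fixes Q :: real and c :: "int \<Rightarrow> int"
  assumes "0 \<le> a0" and Q: "real_of_int (a0 + int N) \<le> Q" "Q \<ge> 1"
    and err: "(real N + real L) * ln Q + Q \<le> real N * real L / 8"
  shows "(\<Sum>a\<in>{a0+1..a0 + int N}. real (card {z\<in>{c a + 1..c a + int L}. coprime z a}))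
            \<ge> real N * real L / 8"
proof -
  define A where "A = {a0+1..a0 + int N}"
  define J where "J a = {c a + 1..c a + int L}" for a
  define M where "M = nat \<lfloor>Q\<rfloor>"
  have M: "real M \<le> Q" "M \<ge> 1" using Q by (auto simp: M_def le_nat_iff le_floor_iff)
  have bad: "{z\<in>J a. \<not> coprime z a} \<subseteq> (\<Union>k\<in>{2..M}. {z\<in>J a. int k dvd a \<and> int k dvd z})"
    if "a \<in> A" for a
  proof
    fix z assume z: "z \<in> {z\<in>J a. \<not> coprime z a}"
    define k where "k = nat (gcd z a)"
    have a: "a > 0" "real_of_int a \<le> Q" using that Q assms(1) by (auto simp: A_def)
    have k: "int k = gcd z a" by (simp add: k_def)
    have "gcd z a \<le> a" using a by (intro zdvd_imp_le) auto
    then have "real k \<le> Q" using k a by linarith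
    then have "k \<le> M" unfolding M_def by (simp add: le_nat_iff le_floor_iff)
    moreover have "k \<ge> 2"
    proof -
      have "gcd z a \<noteq> 1" using z by (simp add: coprime_iff_gcd_eq_1)
      moreover have "gcd z a > 0" using a by simp
      ultimately show ?thesis using k by linarith
    qed
    ultimately show "z \<in> (\<Union>k\<in>{2..M}. {z\<in>J a. int k dvd a \<and> int k dvd z})"
      using z k by (auto intro!: bexI[of _ k])
  qed
  have dv: "real (card {z\<in>J a. int k dvd a \<and> int k dvd z}) \<le>
      (if int k dvd a then real L / k + 1 else 0)" if "k \<ge> 2" for a k
    using card_multiples_le[of "int k" "c a" L] that by (simp add: J_def)
  have "(\<Sum>a\<in>A. real (card {z\<in>J a. \<not> coprime z a})) \<le>
      (\<Sum>a\<in>A. \<Sum>k=2..M. (if int k dvd a then real L / k + 1 else 0))"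
  proof (rule sum_mono)
    fix a assume "a \<in> A"
    have "card {z\<in>J a. \<not> coprime z a} \<le> card (\<Union>k\<in>{2..M}. {z\<in>J a. int k dvd a \<and> int k dvd z})"
      by (rule card_mono[OF _ bad[OF \<open>a \<in> A\<close>]]) (auto simp: J_def simp del: atLeastAtMost_iff)
    also have "\<dots> \<le> (\<Sum>k=2..M. card {z\<in>J a. int k dvd a \<and> int k dvd z})"
      by (rule card_UN_le) simp
    finally have "real (card {z\<in>J a. \<not> coprime z a}) \<le>
        (\<Sum>k=2..M. real (card {z\<in>J a. int k dvd a \<and> int k dvd z}))"
      unfolding of_nat_sum[symmetric] of_nat_le_iff .
    also have "\<dots> \<le> (\<Sum>k=2..M. (if int k dvd a then real L / k + 1 else 0))"
      by (intro sum_mono dv) auto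
    finally show "real (card {z\<in>J a. \<not> coprime z a}) \<le> \<dots>" .
  qed
  also have "\<dots> = (\<Sum>k=2..M. \<Sum>a\<in>A. (if int k dvd a then real L / k + 1 else 0))"
    by (rule sum.swap)
  also have "\<dots> = (\<Sum>k=2..M. real (card {a\<in>A. int k dvd a}) * (real L / k + 1))"
    by (intro sum.cong refl) (simp add: sum.If_cases A_def Int_def)
  also have "\<dots> \<le> (\<Sum>k=2..M. (real N / k + 1) * (real L / k + 1))"
  proof (intro sum_mono mult_right_mono)
    fix k assume "k \<in> {2..M}"
    then show "real (card {a\<in>A. int k dvd a}) \<le> real N / k + 1"
      using card_multiples_le[of "int k" a0 N] by (simp add: A_def)
  qed auto
  also have "\<dots> = (\<Sum>k=2..M. real N * real L * (1 / (real k)\<^sup>2) + (real N + real L) * (1 / real k) + 1)"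
    by (intro sum.cong refl) (auto simp: field_simps power2_eq_square)
  also have "\<dots> = real N * real L * (\<Sum>k=2..M. 1 / (real k)\<^sup>2) +
      (real N + real L) * (\<Sum>k=2..M. 1 / real k) + real (M - 1)"
    by (simp add: sum.distrib sum_distrib_left)
  also have "\<dots> \<le> real N * real L * (3 / 4) + (real N + real L) * ln Q + Q"
  proof (intro add_mono mult_left_mono sum_inverse_squares_le)
    have "(\<Sum>k = 2..M. 1 / real k) \<le> ln (real M)" by (rule sum_inverse_le_ln[OF M(2)])
    also have "\<dots> \<le> ln Q" using M by simp
    finally show "(\<Sum>k = 2..M. 1 / real k) \<le> ln Q" .
  qed (use M in auto)
  also have "\<dots> \<le> real N * real L * (7 / 8)" using err by linarith
  finally have *: "(\<Sum>a\<in>A. real (card {z\<in>J a. \<not> coprime z a})) \<le> real N * real L * (7 / 8)" .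
  have "real N * real L = (\<Sum>a\<in>A. real (card (J a)))" by (simp add: A_def J_def)
  also have "\<dots> = (\<Sum>a\<in>A. real (card {z\<in>J a. coprime z a}) + real (card {z\<in>J a. \<not> coprime z a}))"
  proof (intro sum.cong refl)
    fix a
    have "card (J a) = card ({z\<in>J a. coprime z a} \<union> {z\<in>J a. \<not> coprime z a})"
      by (rule arg_cong[where f = card]) auto
    also have "\<dots> = card {z\<in>J a. coprime z a} + card {z\<in>J a. \<not> coprime z a}"
      by (rule card_Un_disjoint) (auto simp: J_def simp del: atLeastAtMost_iff)
    finally show "real (card (J a)) =
        real (card {z\<in>J a. coprime z a}) + real (card {z\<in>J a. \<not> coprime z a})" by simp
  qed
  finally have "real N * real L = (\<Sum>a\<in>A. real (card {z\<in>J a. coprime z a})) +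
      (\<Sum>a\<in>A. real (card {z\<in>J a. \<not> coprime z a}))" by (simp add: sum.distrib)
  with * show ?thesis by (simp add: A_def J_def)
qed

section \<open>Averaging over product sets\<close>

text \<open>Summing over a product and resampling one coordinate counts every element as often as
  that coordinate has values.\<close>

lemma sum_PiE_fibre:
  fixes f :: "('a \<Rightarrow> 'b) \<Rightarrow> real"
  assumes "i \<in> I" "finite I" "\<And>i. i \<in> I \<Longrightarrow> finite (A i)"
  shows "(\<Sum>b\<in>PiE I A. \<Sum>t\<in>A i. f (b(i := t))) = real (card (A i)) * (\<Sum>b\<in>PiE I A. f b)"
proof -
  have fin: "finite (PiE I A)" using assms by (intro finite_PiE) auto
  have "(\<Sum>b\<in>PiE I A. \<Sum>t\<in>A i. f (b(i := t))) = (\<Sum>(b, t)\<in>PiE I A \<times> A i. f (b(i := t)))"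
    by (rule sum.cartesian_product)
  also have "\<dots> = (\<Sum>(b, t)\<in>PiE I A \<times> A i. f b)"
    \<comment> \<open>the bijection exchanges \<open>t\<close> with the coordinate \<open>b i\<close>\<close>
    by (rule sum.reindex_bij_witness[where i = "\<lambda>(b, t). (b(i := t), b i)" and j = "\<lambda>(b, t). (b(i := t), b i)"])
       (use assms(1) in \<open>auto simp: PiE_iff extensional_def\<close>)
  also have "\<dots> = (\<Sum>b\<in>PiE I A. \<Sum>t\<in>A i. f b)" by (rule sum.cartesian_product[symmetric])
  also have "\<dots> = real (card (A i)) * (\<Sum>b\<in>PiE I A. f b)" by (simp add: sum_distrib_left)
  finally show ?thesis .
qed

section \<open>Hitting cells with a random shear\<close>

text \<open>The inner product of the first \<open>d\<close> coordinates.\<close>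

definition lin :: "nat \<Rightarrow> (nat \<Rightarrow> int) \<Rightarrow> (nat \<Rightarrow> int) \<Rightarrow> int" where
  "lin d \<alpha> b = (\<Sum>i<d. \<alpha> i * b i)"

lemma lin_upd:
  assumes "i < d"
  shows "lin d \<alpha> (b(i := t)) = \<alpha> i * t + (\<Sum>l\<in>{..<d} - {i}. \<alpha> l * b l)"
proof -
  have "lin d \<alpha> (b(i := t)) = \<alpha> i * t + (\<Sum>l\<in>{..<d} - {i}. \<alpha> l * (b(i := t)) l)"
    unfolding lin_def using assms by (subst sum.remove[of _ i]) auto
  also have "(\<Sum>l\<in>{..<d} - {i}. \<alpha> l * (b(i := t)) l) = (\<Sum>l\<in>{..<d} - {i}. \<alpha> l * b l)"
    by (intro sum.cong) auto
  finally show ?thesis .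
qed

lemma lin_diff: "lin d \<alpha> b - lin d \<alpha>' b = lin d (\<lambda>i. \<alpha> i - \<alpha>' i) b"
  by (simp add: lin_def sum_subtractf left_diff_distrib)

lemma real_card_Collect:
  "finite X \<Longrightarrow> real (card {x\<in>X. p x}) = (\<Sum>x\<in>X. of_bool (p x))"
  by (simp add: Int_def)

text \<open>The entries of a row are \<open>\<delta> b\<^sub>i / P\<close> with \<open>0 \<le> b\<^sub>i < P\<close>. The last assumption says that the grid is
  fine enough: the steps of \<open>\<beta>\<^sub>i \<alpha>\<^sub>i\<close>, of size at most \<open>\<delta> Q / P\<close>, do not exceed \<open>\<eta>\<close>. The
  assumption \<open>cells_wide\<close> makes the number \<open>Q / K\<close> of possible values of one coordinate of \<open>\<alpha>\<close> in a cell
  large compared with \<open>ln Q / \<delta>\<close>.\<close>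

locale shear_counting =
  fixes d P K :: nat and \<delta> \<eta> Q :: real
  assumes d: "d \<ge> 1" and delta: "0 < \<delta>" "\<delta> \<le> 1" and Q: "Q \<ge> 1" and K: "K \<ge> 2"
    and eta: "0 < \<eta>" "\<eta> \<le> 1 / 4" and eta_K: "1 \<le> \<eta> * real K"
    and cells_wide: "1536 + 384 * ln Q \<le> \<delta> * (Q / real K)"
    and P: "P \<ge> 2" "Q \<le> \<eta> * real P"
begin

text \<open>The side length of a cell after scaling by \<open>Q\<close>.\<close>

definition width :: real where "width = Q / real K"

definition Row :: "(nat \<Rightarrow> int) set" where "Row = PiE {..<d} (\<lambda>_. {0..<int P})"

lemma finite_Row [simp]: "finite Row" by (auto simp: Row_def intro: finite_PiE)

lemma card_Row: "real (card Row) = real P ^ d"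
  by (simp add: Row_def card_PiE)

lemma ln_Q: "ln Q \<ge> 0" using Q by simp

lemma width_bounds: "1536 \<le> \<delta> * width" "384 * ln Q \<le> \<delta> * width" "1536 \<le> width" "384 * ln Q \<le> width"
  "2 * width \<le> Q"
proof -
  show *: "1536 \<le> \<delta> * width" "384 * ln Q \<le> \<delta> * width"
    using cells_wide ln_Q by (auto simp: width_def)
  have "width \<ge> 0" using Q by (simp add: width_def)
  then have "\<delta> * width \<le> 1 * width" using delta by (intro mult_right_mono) auto
  then show "1536 \<le> width" "384 * ln Q \<le> width" using * by auto
  have "2 * width \<le> real K * width" using K \<open>width \<ge> 0\<close> by (intro mult_right_mono) auto
  then show "2 * width \<le> Q" using K by (simp add: width_def)
qed

lemma delta_Q: "3072 \<le> \<delta> * Q" "768 * ln Q \<le> \<delta> * Q"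
proof -
  have "\<delta> * (2 * width) \<le> \<delta> * Q" using width_bounds(5) delta by (intro mult_left_mono) auto
  then show "3072 \<le> \<delta> * Q" "768 * ln Q \<le> \<delta> * Q" using width_bounds by auto
qed

lemma fibre_card_eq:
  assumes "i < d"
  shows "(\<Sum>b\<in>Row. real (card {t\<in>{0..<int P}. p (b(i := t))})) = real P * real (card {b\<in>Row. p b})"
proof -
  have "(\<Sum>b\<in>Row. \<Sum>t\<in>{0..<int P}. of_bool (p (b(i := t)))) = real P * (\<Sum>b\<in>Row. of_bool (p b))"
    unfolding Row_def using assms by (subst sum_PiE_fibre) auto
  then show ?thesis by (simp only: real_card_Collect finite_Row finite_atLeastLessThan_int)
qed

lemma fibre_card_le:
  assumes "i < d" and "\<And>b. b \<in> Row \<Longrightarrow> real (card {t\<in>{0..<int P}. p (b(i := t))}) \<le> M * of_bool (q b)"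
  shows "real P * real (card {b\<in>Row. p b}) \<le> M * real (card {b\<in>Row. q b})"
proof -
  have "real P * real (card {b\<in>Row. p b}) \<le> (\<Sum>b\<in>Row. M * of_bool (q b))"
    unfolding fibre_card_eq[OF assms(1), symmetric] by (intro sum_mono assms(2))
  also have "\<dots> = M * real (card {b\<in>Row. q b})"
    unfolding real_card_Collect[OF finite_Row] by (rule sum_distrib_left[symmetric])
  finally show ?thesis .
qed

section \<open>First moment\<close>

text \<open>A number of consecutive integers that \<open>\<beta>\<^sub>0 \<alpha>\<^sub>0\<close> certainly passes, for \<open>\<alpha>\<^sub>0 \<ge> Q / 2\<close>. It
  does not depend on \<open>\<alpha>\<^sub>0\<close>, as is needed for counting coprime pairs.\<close>

definition L :: nat where "L = nat \<lfloor>\<delta> * Q / 8\<rfloor>"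

lemma L_bounds: "real L \<le> \<delta> * Q / 8" "\<delta> * Q / 16 \<le> real L"
  using delta_Q unfolding L_def by linarith+

text \<open>Each of the \<open>L\<close> integers passed that lie in \<open>W\<close> accounts for at least \<open>\<eta> P / (\<delta> Q)\<close> values of \<open>t\<close>.\<close>

lemma card_fibre_ge:
  assumes a: "Q / 2 \<le> real_of_int a" "real_of_int a \<le> Q"
  shows "real (card {z\<in>{\<lfloor>\<theta> - \<eta>\<rfloor> - int L + 1..\<lfloor>\<theta> - \<eta>\<rfloor> - int L + int L}. z \<in> W}) * (\<eta> * P / (\<delta> * Q))
      \<le> real (card {t\<in>{0..<int P}. near W \<eta> (\<theta> - \<delta> / P * (a * t))})"
proof -
  define J where "J = {z\<in>{\<lfloor>\<theta> - \<eta>\<rfloor> - int L + 1..\<lfloor>\<theta> - \<eta>\<rfloor> - int L + int L}. z \<in> W}"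
  define k where "k = \<delta> * a / P"
  have P0: "real P > 0" using P by simp
  have a0: "real_of_int a > 0" using a Q by linarith
  have k0: "k > 0" unfolding k_def using P0 a0 delta by simp
  have kP: "\<delta> * Q / 4 \<le> k * (real P - 1)"
  proof -
    have "1 / 2 \<le> (real P - 1) / real P" using P by (simp add: field_simps)
    moreover have "\<delta> * (Q / 2) \<le> \<delta> * a" using a delta by (intro mult_left_mono) auto
    ultimately have "(\<delta> * (Q / 2)) * (1 / 2) \<le> (\<delta> * a) * ((real P - 1) / real P)"
      using delta a0 Q by (intro mult_mono) auto
    then show ?thesis by (simp add: k_def)
  qed
  have "real (card J) * (2 * \<eta> / k - 1) \<le> real (card {b. 0 \<le> real_of_int b \<and> real_of_int b \<le> real P - 1 \<and>
            near W \<eta> (\<theta> - k * real_of_int b)})"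
  proof (rule card_near_ge[OF k0])
    show "finite J" unfolding J_def by (simp del: atLeastAtMost_iff)
    fix z assume z: "z \<in> J"
    have "real_of_int z \<le> \<theta> - \<eta>" using z by (auto simp: J_def le_floor_iff)
    moreover have "real_of_int z \<ge> \<theta> - \<eta> - L"
    proof -
      have "z \<ge> \<lfloor>\<theta> - \<eta>\<rfloor> - int L + 1" using z by (simp add: J_def)
      then have "real_of_int z \<ge> real_of_int (\<lfloor>\<theta> - \<eta>\<rfloor> - int L + 1)" by (simp only: of_int_le_iff)
      then show ?thesis by (simp) linarith
    qed
    moreover have "z \<in> W" using z by (simp add: J_def)
    ultimately show "z \<in> W \<and> k * 0 \<le> \<theta> - z - \<eta> \<and> \<theta> - z + \<eta> \<le> k * (real P - 1)"
      using L_bounds kP eta delta_Q by auto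
  qed (use eta in auto)
  also have "{b. 0 \<le> real_of_int b \<and> real_of_int b \<le> real P - 1 \<and> near W \<eta> (\<theta> - k * real_of_int b)}
      = {t\<in>{0..<int P}. near W \<eta> (\<theta> - \<delta> / P * (a * t))}"
    by (auto simp: k_def mult.assoc)
  finally have *: "real (card J) * (2 * \<eta> / k - 1) \<le> real (card {t\<in>{0..<int P}. near W \<eta> (\<theta> - \<delta> / P * (a * t))})" .
  have "\<eta> * P / (\<delta> * Q) \<le> \<eta> / k"
  proof -
    have "\<eta> / k = \<eta> * P / (\<delta> * a)" by (simp add: k_def)
    moreover have "\<eta> * P / (\<delta> * Q) \<le> \<eta> * P / (\<delta> * a)"
      using a a0 delta eta P0 Q by (intro divide_left_mono mult_left_mono) auto
    ultimately show ?thesis by simp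
  qed
  moreover have "1 \<le> \<eta> * P / (\<delta> * Q)"
  proof -
    have "\<delta> * Q \<le> 1 * Q" using delta Q by (intro mult_right_mono) auto
    also have "1 * Q \<le> \<eta> * P" using P by simp
    finally show ?thesis using delta Q by simp
  qed
  moreover have "x \<le> 2 * y - 1" if "x \<le> y" "1 \<le> x" for x y :: real using that by linarith
  ultimately have "\<eta> * P / (\<delta> * Q) \<le> 2 * (\<eta> / k) - 1" by blast
  then have "\<eta> * P / (\<delta> * Q) \<le> 2 * \<eta> / k - 1" unfolding times_divide_eq_right .
  then have "real (card J) * (\<eta> * P / (\<delta> * Q)) \<le> real (card J) * (2 * \<eta> / k - 1)"
    by (intro mult_left_mono) auto
  with * show ?thesis unfolding J_def by simp
qed

lemma card_fibre_ge':
  assumes a: "Q / 2 \<le> real_of_int a" "real_of_int a \<le> Q"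
  shows "\<eta> * P / 128 \<le> real (card {t\<in>{0..<int P}. near UNIV \<eta> (\<theta> - \<delta> / P * (a * t))})"
proof -
  have "\<eta> * P / 128 \<le> \<eta> * P / 16" using eta P by simp
  also have "\<dots> = (\<delta> * Q / 16) * (\<eta> * P / (\<delta> * Q))" using delta Q by (simp add: field_simps)
  also have "\<dots> \<le> real L * (\<eta> * P / (\<delta> * Q))"
    using L_bounds delta Q eta by (intro mult_right_mono) auto
  also have "\<dots> \<le> real (card {t\<in>{0..<int P}. near UNIV \<eta> (\<theta> - \<delta> / P * (a * t))})"
  proof -
    have "{z\<in>{c - int L + 1..c - int L + int L}. z \<in> UNIV} = {c - int L + 1..c - int L + int L}" for c
      by blast
    then have "card {z\<in>{c - int L + 1..c - int L + int L}. z \<in> UNIV} = L" for c by simp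
    then show ?thesis using card_fibre_ge[OF a, of \<theta> UNIV] by metis
  qed
  finally show ?thesis .
qed

text \<open>The same bound holds with the coprimality condition, on average over the values \<open>a\<close> of \<open>\<alpha>\<^sub>0\<close>.\<close>

lemma sum_card_fibre_coprime_ge:
  fixes a0 :: int and N :: nat and \<theta> :: "int \<Rightarrow> real"
  assumes N: "width / 4 \<le> real N" and a0: "Q / 2 \<le> real_of_int (a0 + 1)" "real_of_int (a0 + int N) \<le> Q"
  shows "real N * (\<eta> * P / 128) \<le>
     (\<Sum>a\<in>{a0+1..a0+int N}. real (card {t\<in>{0..<int P}. near {z. coprime z a} \<eta> (\<theta> a - \<delta> / P * (a * t))}))"
proof -
  define c where "c a = \<lfloor>\<theta> a - \<eta>\<rfloor> - int L" for a
  have "real N * real L / 8 \<le> (\<Sum>a\<in>{a0+1..a0 + int N}. real (card {z\<in>{c a + 1..c a + int L}. coprime z a}))"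
  proof (rule card_coprime_pairs_ge)
    show "0 \<le> a0" using a0(1) Q by linarith
    show "(real N + real L) * ln Q + Q \<le> real N * real L / 8"
    proof -
      have "24 * ln Q \<le> real L" using L_bounds delta_Q by linarith
      then have 1: "real N * (24 * ln Q) \<le> real N * real L" by (intro mult_left_mono) auto
      have "24 * ln Q \<le> real N" using N width_bounds by linarith
      then have 2: "real L * (24 * ln Q) \<le> real L * real N" by (intro mult_left_mono) auto
      have "(width / 4) * (\<delta> * Q / 16) \<le> real N * real L"
        using N L_bounds width_bounds delta Q by (intro mult_mono) auto
      moreover have "1536 * Q \<le> (\<delta> * width) * Q" using width_bounds Q by (intro mult_right_mono) auto
      ultimately have 3: "24 * Q \<le> real N * real L" by (simp add: algebra_simps)
      show ?thesis using 1 2 3 by (simp add: algebra_simps)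
    qed
  qed (use a0 Q in auto)
  then have "real N * real L / 8 * (\<eta> * P / (\<delta> * Q)) \<le>
      (\<Sum>a\<in>{a0+1..a0 + int N}. real (card {z\<in>{c a + 1..c a + int L}. coprime z a})) * (\<eta> * P / (\<delta> * Q))"
    using eta delta Q by (intro mult_right_mono) auto
  also have "\<dots> = (\<Sum>a\<in>{a0+1..a0 + int N}. real (card {z\<in>{c a + 1..c a + int L}. coprime z a}) * (\<eta> * P / (\<delta> * Q)))"
    by (rule sum_distrib_right)
  also have "\<dots> \<le> (\<Sum>a\<in>{a0+1..a0+int N}. real (card {t\<in>{0..<int P}. near {z. coprime z a} \<eta> (\<theta> a - \<delta> / P * (a * t))}))"
  proof (rule sum_mono)
    fix a assume "a \<in> {a0+1..a0 + int N}"
    then have "Q / 2 \<le> real_of_int a" "real_of_int a \<le> Q" using a0 by auto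
    from card_fibre_ge[OF this, of "\<theta> a" "{z. coprime z a}"]
    show "real (card {z\<in>{c a + 1..c a + int L}. coprime z a}) * (\<eta> * P / (\<delta> * Q)) \<le>
      real (card {t\<in>{0..<int P}. near {z. coprime z a} \<eta> (\<theta> a - \<delta> / P * (a * t))})"
      unfolding c_def by simp
  qed
  finally have *: "real N * real L / 8 * (\<eta> * P / (\<delta> * Q)) \<le> \<dots>" .
  have "real N * (\<eta> * P / 128) = real N * (\<delta> * Q / 16) / 8 * (\<eta> * P / (\<delta> * Q))"
    using delta Q by (simp add: field_simps)
  also have "\<dots> \<le> real N * real L / 8 * (\<eta> * P / (\<delta> * Q))"
    using L_bounds delta Q eta by (intro mult_right_mono divide_right_mono mult_left_mono) auto
  finally show ?thesis using * by linarith
qed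

text \<open>The integers \<open>a\<close> such that \<open>a / Q\<close> lies in the middle half of \<open>[k / K, (k + 1) / K]\<close>.\<close>

definition slot :: "nat \<Rightarrow> int set" where
  "slot k = {a. width * (k + 1 / 4) \<le> real_of_int a \<and> real_of_int a \<le> width * (k + 3 / 4)}"

text \<open>The integer vectors \<open>\<alpha>\<close> such that \<open>\<alpha> / Q\<close> lies in the middle of the cell with index \<open>\<kappa>\<close>.\<close>

definition Cell :: "(nat \<Rightarrow> nat) \<Rightarrow> (nat \<Rightarrow> int) set" where
  "Cell \<kappa> = PiE {..<d} (\<lambda>i. slot (\<kappa> i))"

text \<open>The indices of the cells that are used: those in the half \<open>\<xi>\<^sub>0 \<ge> 1/2\<close> of the cube, so that
  \<open>\<alpha>\<^sub>0 \<ge> Q / 2\<close>.\<close>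

definition Cells :: "(nat \<Rightarrow> nat) set" where
  "Cells = PiE {..<d} (\<lambda>i. {k. k < K \<and> (i = 0 \<longrightarrow> K \<le> 2 * k)})"

lemma finite_slot [simp]: "finite (slot k)"
  unfolding slot_def by (rule finite_int_between)

lemma finite_Cell [simp]: "finite (Cell \<kappa>)"
  unfolding Cell_def by (intro finite_PiE) auto

lemma finite_Cells [simp]: "finite Cells"
  unfolding Cells_def by (intro finite_PiE) auto

lemma card_slot: "width / 4 \<le> real (card (slot k))" "real (card (slot k)) \<le> width"
proof -
  have "real (card (slot k)) \<ge> width * (k + 3 / 4) - width * (k + 1 / 4) - 1"
    unfolding slot_def by (rule card_int_between_ge)
  then show "width / 4 \<le> real (card (slot k))" using width_bounds by (simp add: algebra_simps)
  have "real (card (slot k)) \<le> width * (k + 3 / 4) - width * (k + 1 / 4) + 1"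
    unfolding slot_def using width_bounds by (intro card_int_between_le) (simp add: algebra_simps)
  then show "real (card (slot k)) \<le> width" using width_bounds by (simp add: algebra_simps)
qed

lemma card_Cell: "(width / 4) ^ d \<le> real (card (Cell \<kappa>))" "real (card (Cell \<kappa>)) \<le> width ^ d"
proof -
  have eq: "real (card (Cell \<kappa>)) = (\<Prod>i<d. real (card (slot (\<kappa> i))))"
    by (simp add: Cell_def card_PiE)
  have "(\<Prod>i<d. width / 4) \<le> (\<Prod>i<d. real (card (slot (\<kappa> i))))"
    using card_slot width_bounds by (intro prod_mono) auto
  then show "(width / 4) ^ d \<le> real (card (Cell \<kappa>))" by (simp add: eq)
  have "(\<Prod>i<d. real (card (slot (\<kappa> i)))) \<le> (\<Prod>i<d. width)"
    using card_slot width_bounds by (intro prod_mono) auto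
  then show "real (card (Cell \<kappa>)) \<le> width ^ d" by (simp add: eq)
qed

lemma card_Cells: "real K ^ d / 4 \<le> real (card Cells)"
proof -
  have half: "real K / 4 \<le> real (card {k. k < K \<and> K \<le> 2 * k})"
  proof -
    have "{k. k < K \<and> K \<le> 2 * k} = {(K + 1) div 2..<K}" by auto
    moreover have "real K / 4 \<le> real (K - (K + 1) div 2)" using K by linarith
    ultimately show ?thesis by simp
  qed
  have "real (card Cells) = (\<Prod>i<d. real (card {k. k < K \<and> (i = 0 \<longrightarrow> K \<le> 2 * k)}))"
    by (simp add: Cells_def card_PiE)
  also have "\<dots> = real (card {k. k < K \<and> K \<le> 2 * k}) * (\<Prod>i\<in>{..<d}-{0}. real (card {k. k < K \<and> (i = 0 \<longrightarrow> K \<le> 2 * k)}))"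
    using d by (subst prod.remove[of _ 0]) auto
  also have "(\<Prod>i\<in>{..<d}-{0}. real (card {k. k < K \<and> (i = 0 \<longrightarrow> K \<le> 2 * k)})) = (\<Prod>i\<in>{..<d}-{0}. real K)"
    by (intro prod.cong) auto
  also have "\<dots> = real K ^ (d - 1)" using d by simp
  finally have "real (card Cells) = real (card {k. k < K \<and> K \<le> 2 * k}) * real K ^ (d - 1)" .
  moreover have "real K / 4 * real K ^ (d - 1) \<le> real (card {k. k < K \<and> K \<le> 2 * k}) * real K ^ (d - 1)"
    using half by (intro mult_right_mono) auto
  moreover have "real K / 4 * real K ^ (d - 1) = real K ^ d / 4" using d
    by (cases d) auto
  ultimately show ?thesis by simp
qed

lemma slot_0_bounds:
  assumes "a \<in> slot k" "k < K" "K \<le> 2 * k"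
  shows "Q / 2 \<le> real_of_int a" "real_of_int a \<le> Q"
proof -
  have w: "width > 0" using width_bounds by simp
  have Qw: "width * real K = Q" using K by (simp add: width_def)
  have "width * (real K / 2) \<le> width * (k + 1 / 4)" using w assms by (intro mult_left_mono) auto
  then show "Q / 2 \<le> real_of_int a" using assms(1) Qw by (simp add: slot_def)
  have "width * (k + 3 / 4) \<le> width * real K" using w assms by (intro mult_left_mono) auto
  then show "real_of_int a \<le> Q" using assms(1) Qw by (simp add: slot_def)
qed

lemma slot_diff:
  assumes "a \<in> slot k" "b \<in> slot k"
  shows "\<bar>real_of_int (a - b)\<bar> \<le> width / 2"
  using assms unfolding slot_def mem_Collect_eq abs_le_iff of_int_diff distrib_left by linarith

lemma card_row_ge:
  assumes "Q / 2 \<le> real_of_int (\<alpha> 0)" "real_of_int (\<alpha> 0) \<le> Q"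
  shows "\<eta> * real P ^ d / 128 \<le> real (card {b\<in>Row. near UNIV \<eta> (\<theta> - \<delta> / P * lin d \<alpha> b)})"
proof -
  let ?p = "\<lambda>b. near UNIV \<eta> (\<theta> - \<delta> / P * lin d \<alpha> b)"
  have "real P * (\<eta> * real P ^ d / 128) = (\<Sum>b\<in>Row. \<eta> * P / 128)" by (simp add: card_Row)
  also have "\<dots> \<le> (\<Sum>b\<in>Row. real (card {t\<in>{0..<int P}. ?p (b(0 := t))}))"
  proof (rule sum_mono)
    fix b
    define s where "s = (\<Sum>l\<in>{..<d} - {0}. \<alpha> l * b l)"
    have "?p (b(0 := t)) \<longleftrightarrow> near UNIV \<eta> (\<theta> - \<delta> / P * s - \<delta> / P * (\<alpha> 0 * t))" for t
      using d by (subst lin_upd) (auto simp: s_def algebra_simps)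
    then show "\<eta> * P / 128 \<le> real (card {t\<in>{0..<int P}. ?p (b(0 := t))})"
      using card_fibre_ge'[OF assms, of "\<theta> - \<delta> / P * s"] by simp
  qed
  also have "\<dots> = real P * real (card {b\<in>Row. ?p b})" using d by (intro fibre_card_eq) auto
  finally show ?thesis using P by simp
qed

lemma sum_card_row_coprime_ge:
  assumes \<kappa>: "\<kappa> \<in> Cells"
  shows "real (card (Cell \<kappa>)) * (\<eta> * real P ^ d / 128) \<le>
    (\<Sum>\<alpha>\<in>Cell \<kappa>. real (card {b\<in>Row. near {z. coprime z (\<alpha> 0)} \<eta> (\<Theta> \<alpha> - \<delta> / P * lin d \<alpha> b)}))"
proof -
  let ?p = "\<lambda>\<alpha> b. near {z. coprime z (\<alpha> 0)} \<eta> (\<Theta> \<alpha> - \<delta> / P * lin d \<alpha> b)"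
  have k0: "\<kappa> 0 < K" "K \<le> 2 * \<kappa> 0" using \<kappa> d by (auto simp: Cells_def PiE_iff)
  define N where "N = card (slot (\<kappa> 0))"
  define a0 where "a0 = \<lceil>width * (\<kappa> 0 + 1 / 4)\<rceil> - 1"
  have N0: "N > 0" using card_slot(1)[of "\<kappa> 0"] width_bounds by (simp add: N_def)
  have slot: "slot (\<kappa> 0) = {a0 + 1..\<lfloor>width * (\<kappa> 0 + 3 / 4)\<rfloor>}"
    by (auto simp: slot_def a0_def ceiling_le_iff le_floor_iff)
  then have "N = nat (\<lfloor>width * (\<kappa> 0 + 3 / 4)\<rfloor> - a0)" by (simp add: N_def)
  then have slot: "slot (\<kappa> 0) = {a0 + 1..a0 + int N}" using N0 slot by auto
  have bd: "Q / 2 \<le> real_of_int (a0 + 1)" "real_of_int (a0 + int N) \<le> Q"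
    using slot_0_bounds[OF _ k0, of "a0 + 1"] slot_0_bounds[OF _ k0, of "a0 + int N"] N0 slot by auto
  have "real P * (real N * (real (card (Cell \<kappa>)) * (\<eta> * real P ^ d / 128)))
      = (\<Sum>\<alpha>\<in>Cell \<kappa>. \<Sum>b\<in>Row. real N * (\<eta> * P / 128))" by (simp add: card_Row)
  also have "\<dots> \<le> (\<Sum>\<alpha>\<in>Cell \<kappa>. \<Sum>b\<in>Row. \<Sum>a\<in>slot (\<kappa> 0). real (card {t\<in>{0..<int P}. ?p (\<alpha>(0 := a)) (b(0 := t))}))"
  proof (intro sum_mono)
    fix \<alpha> b :: "nat \<Rightarrow> int"
    define s where "s = (\<Sum>l\<in>{..<d} - {0}. \<alpha> l * b l)"
    have s: "(\<Sum>l\<in>{..<d} - {0}. (\<alpha>(0 := a)) l * b l) = s" for a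
      unfolding s_def by (intro sum.cong) auto
    have "0 < d" using d by simp
    then have "lin d (\<alpha>(0 := a)) (b(0 := t)) = a * t + s" for a t
      unfolding lin_upd[OF \<open>0 < d\<close>] s by simp
    then have "?p (\<alpha>(0 := a)) (b(0 := t)) \<longleftrightarrow>
        near {z. coprime z a} \<eta> (\<Theta> (\<alpha>(0 := a)) - \<delta> / P * s - \<delta> / P * (a * t))" for a t
      by (simp add: algebra_simps)
    then show "real N * (\<eta> * P / 128) \<le> (\<Sum>a\<in>slot (\<kappa> 0). real (card {t\<in>{0..<int P}. ?p (\<alpha>(0 := a)) (b(0 := t))}))"
      unfolding slot
      using sum_card_fibre_coprime_ge[OF _ bd, of "\<lambda>a. \<Theta> (\<alpha>(0 := a)) - \<delta> / P * s"] card_slot(1)[of "\<kappa> 0"]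
      by (simp add: N_def)
  qed
  also have "\<dots> = (\<Sum>\<alpha>\<in>Cell \<kappa>. \<Sum>a\<in>slot (\<kappa> 0). \<Sum>b\<in>Row. real (card {t\<in>{0..<int P}. ?p (\<alpha>(0 := a)) (b(0 := t))}))"
    by (intro sum.cong refl sum.swap)
  also have "\<dots> = (\<Sum>\<alpha>\<in>Cell \<kappa>. \<Sum>a\<in>slot (\<kappa> 0). real P * real (card {b\<in>Row. ?p (\<alpha>(0 := a)) b}))"
    using d by (intro sum.cong refl fibre_card_eq) auto
  also have "\<dots> = real N * (\<Sum>\<alpha>\<in>Cell \<kappa>. real P * real (card {b\<in>Row. ?p \<alpha> b}))"
    unfolding Cell_def N_def using d by (intro sum_PiE_fibre) auto
  also have "\<dots> = real P * (real N * (\<Sum>\<alpha>\<in>Cell \<kappa>. real (card {b\<in>Row. ?p \<alpha> b})))"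
    by (simp add: sum_distrib_left mult.left_commute)
  finally show ?thesis using P N0 by simp
qed

section \<open>Second moment\<close>

lemma card_fibre_le:
  assumes "k \<noteq> 0" "\<eta>' \<ge> 0"
  shows "real (card {t\<in>{0..<int P}. near UNIV \<eta>' (\<theta> - k * real_of_int t)}) \<le>
    (\<bar>k\<bar> * P + 2 * \<eta>' + 1) * (2 * \<eta>' / \<bar>k\<bar> + 1)"
proof -
  have pos: "real (card {t\<in>{0..<int P}. near UNIV \<eta>' (\<theta> - k * real_of_int t)}) \<le>
    (\<bar>k\<bar> * P + 2 * \<eta>' + 1) * (2 * \<eta>' / \<bar>k\<bar> + 1)" if k: "k > 0" for k \<theta>
  proof -
    have "card {t\<in>{0..<int P}. near UNIV \<eta>' (\<theta> - k * real_of_int t)} \<le>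
        card {b::int. 0 \<le> real_of_int b \<and> real_of_int b \<le> 0 + real P \<and> near UNIV \<eta>' (\<theta> - k * real_of_int b)}"
      by (rule card_mono) (auto intro: finite_subset[OF _ finite_int_between[of 0 "0 + real P"]])
    with card_near_le[OF k assms(2), of "real P" 0 \<theta>] k show ?thesis by simp
  qed
  show ?thesis
  proof (cases "k > 0")
    case True
    then show ?thesis using pos by simp
  next
    case False
    have "near UNIV \<eta>' (\<theta> - k * real_of_int t) \<longleftrightarrow> near UNIV \<eta>' (- \<theta> - (- k) * real_of_int t)" for t
      using near_uminus[of \<eta>' "\<theta> - k * real_of_int t"] by simp
    then show ?thesis using pos[of "- k" "- \<theta>"] False assms by simp
  qed
qed

text \<open>Two linear functions of the single variable \<open>t\<close> are simultaneously near integers with the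
  probability \<open>O(\<eta>\<^sup>2)\<close> of independent events, because their slopes differ by much less than each of them.\<close>

lemma card_pair_le_neq:
  assumes a: "Q / 2 \<le> real_of_int a" "a' < a" "real_of_int (a - a') \<le> width / 2" "a \<le> Q"
  shows "real (card {t\<in>{0..<int P}. near UNIV \<eta> (\<theta> - \<delta> / P * (real_of_int a * real_of_int t)) \<and> near UNIV \<eta> (\<theta>' - \<delta> / P * (real_of_int a' * real_of_int t))})
    \<le> 256 / \<delta> * \<eta>\<^sup>2 * P"
proof -
  define k where "k = \<delta> * a / P"
  define w where "w = real_of_int (a - a')"
  define k' where "k' = \<delta> * w / P"
  have P0: "real P > 0" using P by simp
  have a0: "real_of_int a > 0" using a Q by linarith
  have w: "1 \<le> w" "w \<le> width / 2" using a by (auto simp: w_def)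
  have k0: "k > 0" "k' > 0" unfolding k_def k'_def using P0 a0 delta w by simp_all
  have "{t\<in>{0..<int P}. near UNIV \<eta> (\<theta> - \<delta> / P * (real_of_int a * real_of_int t)) \<and> near UNIV \<eta> (\<theta>' - \<delta> / P * (real_of_int a' * real_of_int t))}
    \<subseteq> {b::int. 0 \<le> real_of_int b \<and> real_of_int b \<le> 0 + real P \<and>
            near UNIV \<eta> (\<theta> - k * real_of_int b) \<and> near UNIV (2 * \<eta>) ((\<theta> - \<theta>') - k' * real_of_int b)}" (is "?A \<subseteq> ?B")
  proof
    fix t assume t: "t \<in> ?A"
    have eq: "(\<theta> - \<delta> / P * (real_of_int a * real_of_int t)) - (\<theta>' - \<delta> / P * (real_of_int a' * real_of_int t)) = (\<theta> - \<theta>') - k' * real_of_int t"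
      by (simp add: k'_def w_def algebra_simps diff_divide_distrib)
    have "near UNIV (2 * \<eta>) ((\<theta> - \<theta>') - k' * real_of_int t)"
      using t unfolding eq[symmetric] by (intro near_diff) auto
    moreover have "\<theta> - \<delta> / P * (real_of_int a * real_of_int t) = \<theta> - k * real_of_int t" by (simp add: k_def)
    ultimately show "t \<in> ?B" using t by simp
  qed
  then have "real (card ?A) \<le> real (card ?B)"
    by (intro of_nat_mono card_mono) (auto intro: finite_subset[OF _ finite_int_between[of 0 "0 + real P"]])
  also have "\<dots> \<le> (k' * P + 2 * (2 * \<eta>) + 1) * ((k * (2 * (2 * \<eta>) / k') + 2 * \<eta> + 1) * (2 * \<eta> / k + 1))"
    using k0 eta P0 by (intro card_near_near_le) auto
  also have "\<dots> \<le> (4 * w) * ((6 * \<eta> * a / w) * (4 * \<eta> * P / (\<delta> * a)))"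
  proof (intro mult_mono)
    have "k' * P = \<delta> * w" using P0 by (simp add: k'_def)
    moreover have "\<delta> * w \<le> 1 * w" using delta w by (intro mult_right_mono) auto
    ultimately show "k' * P + 2 * (2 * \<eta>) + 1 \<le> 4 * w" using eta w by linarith
    \<comment> \<open>the slopes are at least \<open>K\<close> times their difference, and \<open>\<eta> K \<ge> 1\<close>\<close>
    have "K * w \<le> a"
    proof -
      have "K * w \<le> K * (width / 2)" using w by (intro mult_left_mono) auto
      also have "\<dots> = Q / 2" using K by (simp add: width_def)
      finally show ?thesis using a by linarith
    qed
    then have "\<eta> * (K * w) \<le> \<eta> * a" using eta by (intro mult_left_mono) auto
    moreover have "1 * w \<le> (\<eta> * K) * w" using eta_K w by (intro mult_right_mono) auto
    ultimately have "w \<le> \<eta> * a" by (simp add: mult.assoc)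
    then have "1 \<le> \<eta> * a / w" using w by simp
    moreover have "k * (2 * (2 * \<eta>) / k') = 4 * (\<eta> * a / w)"
      using P0 delta w by (simp add: k_def k'_def field_simps)
    moreover have "6 * \<eta> * a / w = 6 * (\<eta> * a / w)" by simp
    moreover have "4 * x + 2 * \<eta> + 1 \<le> 6 * x" if "1 \<le> x" for x using that eta by linarith
    ultimately show "k * (2 * (2 * \<eta>) / k') + 2 * \<eta> + 1 \<le> 6 * \<eta> * a / w" by metis
    have "\<delta> * a \<le> 1 * Q" using delta a a0 by (intro mult_mono) auto
    then have "\<delta> * a \<le> \<eta> * P" using P by simp
    then have "1 \<le> \<eta> * P / (\<delta> * a)" using delta a0 by simp
    moreover have "2 * \<eta> / k = 2 * (\<eta> * P / (\<delta> * a))" by (simp add: k_def)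
    moreover have "4 * \<eta> * P / (\<delta> * a) = 4 * (\<eta> * P / (\<delta> * a))" by simp
    moreover have "2 * x + 1 \<le> 4 * x" if "1 \<le> x" for x :: real using that by linarith
    ultimately show "2 * \<eta> / k + 1 \<le> 4 * \<eta> * P / (\<delta> * a)" by metis
  qed (use w eta k0 a0 P0 delta in auto)
  also have "\<dots> = 96 / \<delta> * \<eta>\<^sup>2 * P"
    using w a0 by (simp add: field_simps power2_eq_square)
  also have "\<dots> \<le> 256 / \<delta> * \<eta>\<^sup>2 * P"
    using delta by (intro mult_right_mono divide_right_mono) auto
  finally show ?thesis .
qed

lemma card_row_pair_le:
  assumes \<kappa>: "\<kappa> \<in> Cells" and \<alpha>: "\<alpha> \<in> Cell \<kappa>" "\<alpha>' \<in> Cell \<kappa>" "\<alpha> \<noteq> \<alpha>'"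
  shows "real (card {b\<in>Row. near UNIV \<eta> (\<theta> - \<delta> / P * lin d \<alpha> b) \<and> near UNIV \<eta> (\<theta>' - \<delta> / P * lin d \<alpha>' b)})
      \<le> 256 / \<delta> * \<eta>\<^sup>2 * real P ^ d"
proof -
  have d0: "0 < d" using d by simp
  have P0: "real P > 0" using P by simp
  have k0: "\<kappa> 0 < K" "K \<le> 2 * \<kappa> 0" using \<kappa> d by (auto simp: Cells_def PiE_iff)
  have sl: "\<alpha> i \<in> slot (\<kappa> i)" "\<alpha>' i \<in> slot (\<kappa> i)" if "i < d" for i
    using \<alpha> that by (auto simp: Cell_def PiE_iff)
  note bd = slot_0_bounds[OF sl(1)[OF d0] k0] slot_0_bounds[OF sl(2)[OF d0] k0]
  let ?p = "\<lambda>b. near UNIV \<eta> (\<theta> - \<delta> / P * lin d \<alpha> b) \<and> near UNIV \<eta> (\<theta>' - \<delta> / P * lin d \<alpha>' b)"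
  show ?thesis
  proof (cases "\<alpha> 0 = \<alpha>' 0")
    case False
    \<comment> \<open>both conditions are resolved by the entry \<open>0\<close> of the row\<close>
    have "real P * real (card {b\<in>Row. ?p b}) \<le> (256 / \<delta> * \<eta>\<^sup>2 * P) * real (card {b\<in>Row. True})"
    proof (rule fibre_card_le[OF d0])
      fix b
      define s where "s = (\<Sum>l\<in>{..<d} - {0}. \<alpha> l * b l)"
      define s' where "s' = (\<Sum>l\<in>{..<d} - {0}. \<alpha>' l * b l)"
      define \<psi> where "\<psi> = \<theta> - \<delta> / P * s"
      define \<psi>' where "\<psi>' = \<theta>' - \<delta> / P * s'"
      have "\<theta> - \<delta> / P * lin d \<alpha> (b(0 := t)) = \<psi> - \<delta> / P * (real_of_int (\<alpha> 0) * real_of_int t)"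
           "\<theta>' - \<delta> / P * lin d \<alpha>' (b(0 := t)) = \<psi>' - \<delta> / P * (real_of_int (\<alpha>' 0) * real_of_int t)" for t
        unfolding lin_upd[OF d0] s_def[symmetric] s'_def[symmetric] \<psi>_def \<psi>'_def
        by (simp_all add: algebra_simps)
      then have eq: "?p (b(0 := t)) \<longleftrightarrow> near UNIV \<eta> (\<psi> - \<delta> / P * (real_of_int (\<alpha> 0) * real_of_int t)) \<and>
          near UNIV \<eta> (\<psi>' - \<delta> / P * (real_of_int (\<alpha>' 0) * real_of_int t))" for t by simp
      have df: "real_of_int (\<alpha> 0 - \<alpha>' 0) \<le> width / 2" "real_of_int (\<alpha>' 0 - \<alpha> 0) \<le> width / 2"
        using slot_diff[OF sl(1)[OF d0] sl(2)[OF d0]] unfolding abs_le_iff of_int_diff by linarith+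
      have "real (card {t\<in>{0..<int P}. near UNIV \<eta> (\<psi> - \<delta> / P * (real_of_int (\<alpha> 0) * real_of_int t)) \<and>
          near UNIV \<eta> (\<psi>' - \<delta> / P * (real_of_int (\<alpha>' 0) * real_of_int t))}) \<le> 256 / \<delta> * \<eta>\<^sup>2 * P"
      proof (cases "\<alpha>' 0 < \<alpha> 0")
        case True
        then show ?thesis using card_pair_le_neq[of "\<alpha> 0" "\<alpha>' 0" \<psi> \<psi>'] bd df by blast
      next
        case False
        then have "\<alpha> 0 < \<alpha>' 0" using \<open>\<alpha> 0 \<noteq> \<alpha>' 0\<close> by simp
        then show ?thesis using card_pair_le_neq[of "\<alpha>' 0" "\<alpha> 0" \<psi>' \<psi>] bd df
          by (subst conj_commute) blast
      qed
      then show "real (card {t\<in>{0..<int P}. ?p (b(0 := t))}) \<le> 256 / \<delta> * \<eta>\<^sup>2 * P * of_bool True"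
        unfolding eq by simp
    qed
    then have "real P * real (card {b\<in>Row. ?p b}) \<le> real P * (256 / \<delta> * \<eta>\<^sup>2 * real P ^ d)"
      by (simp add: card_Row mult_ac)
    then show ?thesis using P0 by (rule mult_left_le_imp_le)
  next
    case True
    \<comment> \<open>the difference of the conditions is independent of the entry \<open>0\<close> and is resolved by the entry \<open>i\<close>\<close>
    obtain i where i: "i < d" "\<alpha> i \<noteq> \<alpha>' i"
      using \<alpha> unfolding Cell_def by (metis PiE_ext lessThan_iff)
    define w where "w = (\<lambda>i. \<alpha> i - \<alpha>' i)"
    have w0: "w 0 = 0" using True by (simp add: w_def)
    have wi: "1 \<le> \<bar>real_of_int (w i)\<bar>" using i unfolding w_def by linarith
    have wi0: "w i \<noteq> 0" using i by (simp add: w_def)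
    define q where "q b \<longleftrightarrow> near UNIV (2 * \<eta>) (\<theta> - \<theta>' - \<delta> / P * lin d w b)" for b
    have pq: "q b" if "?p b" for b
    proof -
      have "(\<theta> - \<delta> / P * lin d \<alpha> b) - (\<theta>' - \<delta> / P * lin d \<alpha>' b) =
          \<theta> - \<theta>' - \<delta> / P * real_of_int (lin d \<alpha> b - lin d \<alpha>' b)"
        unfolding of_int_diff right_diff_distrib by simp
      then show ?thesis
        unfolding q_def w_def lin_diff[symmetric] using that by (metis near_diff)
    qed
    have "real P * real (card {b\<in>Row. ?p b}) \<le> (8 * \<eta> * P) * real (card {b\<in>Row. q b})"
    proof (rule fibre_card_le[OF d0])
      fix b
      have qb: "q (b(0 := t)) \<longleftrightarrow> q b" for t
        unfolding q_def using lin_upd[OF d0, of w b t] lin_upd[OF d0, of w b "b 0"] w0 by simp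
      define s where "s = (\<Sum>l\<in>{..<d} - {0}. \<alpha> l * b l)"
      define \<psi> where "\<psi> = \<theta> - \<delta> / P * s"
      define k where "k = \<delta> * \<alpha> 0 / P"
      have a0: "real_of_int (\<alpha> 0) > 0" using bd Q by linarith
      have k0: "k > 0" using P0 delta a0 by (simp add: k_def)
      have eq: "\<theta> - \<delta> / P * lin d \<alpha> (b(0 := t)) = \<psi> - k * t" for t
        unfolding lin_upd[OF d0] s_def[symmetric] \<psi>_def k_def
        by (simp add: algebra_simps)
      show "real (card {t\<in>{0..<int P}. ?p (b(0 := t))}) \<le> 8 * \<eta> * P * of_bool (q b)"
      proof (cases "q b")
        case False
        then have empty: "{t\<in>{0..<int P}. ?p (b(0 := t))} = {}" using pq qb by blast
        show ?thesis unfolding empty using False by simp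
      next
        case True
        have "{t\<in>{0..<int P}. ?p (b(0 := t))} \<subseteq> {t\<in>{0..<int P}. near UNIV \<eta> (\<psi> - k * real_of_int t)}"
          unfolding eq by blast
        then have "card {t\<in>{0..<int P}. ?p (b(0 := t))} \<le> card {t\<in>{0..<int P}. near UNIV \<eta> (\<psi> - k * real_of_int t)}"
          by (intro card_mono) (simp_all del: atLeastLessThan_iff)
        also have "real \<dots> \<le> (\<bar>k\<bar> * P + 2 * \<eta> + 1) * (2 * \<eta> / \<bar>k\<bar> + 1)"
          using k0 eta by (intro card_fibre_le) auto
        also have "\<dots> \<le> (2 * (\<delta> * \<alpha> 0)) * (4 * (\<eta> * P / (\<delta> * \<alpha> 0)))"
        proof (intro mult_mono)
          have "\<delta> * (Q / 2) \<le> \<delta> * \<alpha> 0" using bd delta by (intro mult_left_mono) auto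
          moreover have "\<bar>k\<bar> * P = \<delta> * \<alpha> 0" using P0 unfolding abs_of_pos[OF k0] by (simp add: k_def)
          ultimately show "\<bar>k\<bar> * P + 2 * \<eta> + 1 \<le> 2 * (\<delta> * \<alpha> 0)" using delta_Q eta by linarith
          have "\<delta> * \<alpha> 0 \<le> 1 * Q" using delta a0 bd by (intro mult_mono) auto
          then have "\<delta> * \<alpha> 0 \<le> \<eta> * P" using P by simp
          then have "1 \<le> \<eta> * P / (\<delta> * \<alpha> 0)" using delta a0 by simp
          moreover have "2 * \<eta> / \<bar>k\<bar> = 2 * (\<eta> * P / (\<delta> * \<alpha> 0))" unfolding abs_of_pos[OF k0] by (simp add: k_def)
          moreover have "2 * x + 1 \<le> 4 * x" if "1 \<le> x" for x :: real using that by linarith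
          ultimately show "2 * \<eta> / \<bar>k\<bar> + 1 \<le> 4 * (\<eta> * P / (\<delta> * \<alpha> 0))" by metis
        qed (use delta eta a0 P0 in auto)
        also have "\<dots> = 8 * \<eta> * P" using delta a0 by (simp add: field_simps)
        finally show ?thesis using True by simp
      qed
    qed
    moreover have "real P * real (card {b\<in>Row. q b}) \<le> (32 * \<eta> / \<delta> * P) * real (card {b\<in>Row. True})"
    proof (rule fibre_card_le[OF i(1)])
      fix b
      define s where "s = (\<Sum>l\<in>{..<d} - {i}. w l * b l)"
      define \<psi> where "\<psi> = \<theta> - \<theta>' - \<delta> / P * s"
      define k where "k = \<delta> * w i / P"
      define u where "u = \<bar>real_of_int (w i)\<bar>"
      have u: "1 \<le> u" using wi by (simp add: u_def)
      have k0: "k \<noteq> 0" using P0 delta wi0 by (simp add: k_def)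
      have ak: "\<bar>k\<bar> = \<delta> * u / P" using delta P0 by (simp add: k_def u_def abs_mult)
      have uQ: "u \<le> Q"
        using slot_diff[OF sl(1)[OF i(1)] sl(2)[OF i(1)]] width_bounds by (simp add: u_def w_def)
      have eq: "\<theta> - \<theta>' - \<delta> / P * lin d w (b(i := t)) = \<psi> - k * t" for t
        unfolding lin_upd[OF i(1)] s_def[symmetric] \<psi>_def k_def
        by (simp add: algebra_simps)
      have "real (card {t\<in>{0..<int P}. q (b(i := t))}) \<le> (\<bar>k\<bar> * P + 2 * (2 * \<eta>) + 1) * (2 * (2 * \<eta>) / \<bar>k\<bar> + 1)"
        unfolding q_def eq using k0 eta by (intro card_fibre_le) auto
      also have "\<dots> \<le> (4 * u) * (8 * (\<eta> * P / (\<delta> * u)))"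
      proof (intro mult_mono)
        have "\<delta> * u \<le> 1 * u" using delta u by (intro mult_right_mono) auto
        moreover have "\<bar>k\<bar> * P = \<delta> * u" using ak P0 by simp
        ultimately show "\<bar>k\<bar> * P + 2 * (2 * \<eta>) + 1 \<le> 4 * u" using eta u by linarith
        have "\<delta> * u \<le> 1 * Q" using delta u uQ by (intro mult_mono) auto
        then have "\<delta> * u \<le> \<eta> * P" using P by simp
        then have "1 \<le> \<eta> * P / (\<delta> * u)" using delta u by simp
        moreover have "2 * (2 * \<eta>) / \<bar>k\<bar> = 4 * (\<eta> * P / (\<delta> * u))" by (simp add: ak)
        moreover have "4 * x + 1 \<le> 8 * x" if "1 \<le> x" for x :: real using that by linarith
        ultimately show "2 * (2 * \<eta>) / \<bar>k\<bar> + 1 \<le> 8 * (\<eta> * P / (\<delta> * u))" by metis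
      qed (use delta eta u P0 in auto)
      also have "\<dots> = 32 * \<eta> / \<delta> * P" using delta u by (simp add: field_simps)
      finally show "real (card {t\<in>{0..<int P}. q (b(i := t))}) \<le> 32 * \<eta> / \<delta> * P * of_bool True" by simp
    qed
    then have "real P * real (card {b\<in>Row. q b}) \<le> real P * (32 * \<eta> / \<delta> * real P ^ d)"
      by (simp add: card_Row mult_ac)
    then have "real (card {b\<in>Row. q b}) \<le> 32 * \<eta> / \<delta> * real P ^ d"
      using P0 by (rule mult_left_le_imp_le)
    then have "(8 * \<eta> * P) * real (card {b\<in>Row. q b}) \<le> (8 * \<eta> * P) * (32 * \<eta> / \<delta> * real P ^ d)"
      using eta by (intro mult_left_mono) auto
    moreover have "(8 * \<eta> * P) * (32 * \<eta> / \<delta> * real P ^ d) = real P * (256 / \<delta> * \<eta>\<^sup>2 * real P ^ d)"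
      by (simp add: power2_eq_square)
    ultimately have "real P * real (card {b\<in>Row. ?p b}) \<le> real P * (256 / \<delta> * \<eta>\<^sup>2 * real P ^ d)" by linarith
    then show ?thesis using P0 by (rule mult_left_le_imp_le)
  qed
qed

end

text \<open>A Bonferroni inequality. The sum over ordered pairs is twice what is necessary, which makes no
  difference below.\<close>

lemma of_bool_ex_ge:
  assumes "finite S"
  shows "(\<Sum>x\<in>S. of_bool (p x)) - (\<Sum>x\<in>S. \<Sum>y\<in>S - {x}. of_bool (p x \<and> p y)) \<le> (of_bool (\<exists>x\<in>S. p x) :: real)"
proof -
  define X where "X = real (card {x\<in>S. p x})"
  have X: "(\<Sum>x\<in>S. of_bool (p x)) = X" using assms by (simp only: X_def real_card_Collect)
  have "(\<Sum>y\<in>S - {x}. of_bool (p x \<and> p y)) = of_bool (p x) * (X - 1)" if "x \<in> S" for x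
  proof (cases "p x")
    case True
    have "X = of_bool (p x) + (\<Sum>y\<in>S - {x}. of_bool (p y))"
      unfolding X[symmetric] using assms that by (rule sum.remove)
    then show ?thesis using True by simp
  qed simp
  then have "(\<Sum>x\<in>S. \<Sum>y\<in>S - {x}. of_bool (p x \<and> p y)) = (\<Sum>x\<in>S. of_bool (p x) * (X - 1))"
    by (intro sum.cong) auto
  also have "\<dots> = X * (X - 1)" unfolding X[symmetric] by (rule sum_distrib_right[symmetric])
  finally have eq: "(\<Sum>x\<in>S. of_bool (p x)) - (\<Sum>x\<in>S. \<Sum>y\<in>S - {x}. of_bool (p x \<and> p y)) = X - X * (X - 1)"
    using X by simp
  show ?thesis
  proof (cases "\<exists>x\<in>S. p x")
    case True
    have "0 \<le> (X - 1)\<^sup>2" by simp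
    then show ?thesis unfolding eq using True by (simp add: power2_eq_square algebra_simps)
  next
    case False
    then have "{x\<in>S. p x} = {}" by blast
    then have "X = 0" unfolding X_def by (simp only: card.empty of_nat_0)
    then show ?thesis unfolding eq using False by simp
  qed
qed

context shear_counting
begin

text \<open>The integer matrices \<open>B\<close> that give rise to the shears with \<open>\<beta> = (\<delta> / P) B\<close>.\<close>

definition Shears :: "nat \<Rightarrow> (nat \<Rightarrow> nat \<Rightarrow> int) set" where
  "Shears m = PiE {..<m} (\<lambda>_. Row)"

text \<open>The inverse of the shear given by \<open>B\<close> takes some point of \<open>Q\<^sup>-\<^sup>1 \<int>\<^sup>n\<close> with the first coordinates
  \<open>\<alpha> / Q\<close> close to the graph, where \<open>\<Theta> \<alpha> j\<close> stands for \<open>Q \<phi>\<^sub>j (\<alpha> / Q)\<close>. The condition on the row \<open>0\<close> ensures that the point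
  comes from a primitive vector.\<close>

definition hits :: "nat \<Rightarrow> ((nat \<Rightarrow> int) \<Rightarrow> nat \<Rightarrow> real) \<Rightarrow> (nat \<Rightarrow> int) \<Rightarrow> (nat \<Rightarrow> nat \<Rightarrow> int) \<Rightarrow> bool" where
  "hits m \<Theta> \<alpha> B \<longleftrightarrow> (\<forall>j<m. near (if j = 0 then {z. coprime z (\<alpha> 0)} else UNIV) \<eta>
      (\<Theta> \<alpha> j - \<delta> / P * lin d \<alpha> (B j)))"

lemma finite_Shears [simp]: "finite (Shears m)"
  unfolding Shears_def by (intro finite_PiE) auto

lemma card_Shears: "real (card (Shears m)) = (real P ^ d) ^ m"
  by (simp add: Shears_def card_PiE card_Row)

lemma Shears_nonempty: "Shears m \<noteq> {}"
proof -
  have "real (card (Shears m)) > 0" unfolding card_Shears using P by simp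
  then show ?thesis by auto
qed

lemma card_Shears_rowwise:
  "real (card {B\<in>Shears m. \<forall>j<m. p j (B j)}) = (\<Prod>j<m. real (card {b\<in>Row. p j b}))"
proof -
  have eq: "{B\<in>Shears m. \<forall>j<m. p j (B j)} = PiE {..<m} (\<lambda>j. {b\<in>Row. p j b})"
    unfolding Shears_def PiE_iff set_eq_iff mem_Collect_eq by blast
  show ?thesis unfolding eq by (simp only: card_PiE finite_lessThan of_nat_prod)
qed

lemma first_moment_ge:
  assumes \<kappa>: "\<kappa> \<in> Cells" and m: "m \<ge> 1"
  shows "real (card (Cell \<kappa>)) * (\<eta> * real P ^ d / 128) ^ m \<le>
     (\<Sum>\<alpha>\<in>Cell \<kappa>. real (card {B\<in>Shears m. hits m \<Theta> \<alpha> B}))"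
proof -
  define c where "c = \<eta> * real P ^ d / 128"
  have c0: "c \<ge> 0" using eta by (simp add: c_def)
  define R where "R j \<alpha> = real (card {b\<in>Row. near (if j = 0 then {z. coprime z (\<alpha> 0)} else UNIV) \<eta>
      (\<Theta> \<alpha> j - \<delta> / P * lin d \<alpha> b)})" for j \<alpha>
  have k0: "\<kappa> 0 < K" "K \<le> 2 * \<kappa> 0" using \<kappa> d by (auto simp: Cells_def PiE_iff)
  have "real (card (Cell \<kappa>)) * c ^ m = (real (card (Cell \<kappa>)) * c) * c ^ (m - 1)"
    using m by (simp add: power_eq_if)
  also have "\<dots> \<le> (\<Sum>\<alpha>\<in>Cell \<kappa>. R 0 \<alpha>) * c ^ (m - 1)"
    using sum_card_row_coprime_ge[OF \<kappa>, of "\<lambda>\<alpha>. \<Theta> \<alpha> 0"] c0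
    unfolding R_def c_def by (intro mult_right_mono) simp_all
  also have "\<dots> = (\<Sum>\<alpha>\<in>Cell \<kappa>. R 0 \<alpha> * c ^ (m - 1))" by (rule sum_distrib_right)
  also have "\<dots> \<le> (\<Sum>\<alpha>\<in>Cell \<kappa>. real (card {B\<in>Shears m. hits m \<Theta> \<alpha> B}))"
  proof (rule sum_mono)
    fix \<alpha> assume "\<alpha> \<in> Cell \<kappa>"
    then have "\<alpha> 0 \<in> slot (\<kappa> 0)" using d by (auto simp: Cell_def PiE_iff)
    note bd = slot_0_bounds[OF this k0]
    have "c ^ (m - 1) = (\<Prod>j\<in>{..<m} - {0}. c)" using m by simp
    also have "\<dots> \<le> (\<Prod>j\<in>{..<m} - {0}. R j \<alpha>)"
      using card_row_ge[where \<alpha> = \<alpha>, OF bd] c0 by (intro prod_mono) (auto simp: R_def c_def)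
    finally have "R 0 \<alpha> * c ^ (m - 1) \<le> R 0 \<alpha> * (\<Prod>j\<in>{..<m} - {0}. R j \<alpha>)"
      by (intro mult_left_mono) (auto simp: R_def)
    also have "\<dots> = (\<Prod>j<m. R j \<alpha>)" using m by (subst (2) prod.remove[of _ 0]) auto
    also have "\<dots> = real (card {B\<in>Shears m. hits m \<Theta> \<alpha> B})"
      unfolding hits_def R_def by (rule card_Shears_rowwise[symmetric])
    finally show "R 0 \<alpha> * c ^ (m - 1) \<le> real (card {B\<in>Shears m. hits m \<Theta> \<alpha> B})" .
  qed
  finally show ?thesis by (simp add: c_def)
qed

lemma pair_le:
  assumes \<kappa>: "\<kappa> \<in> Cells" and \<alpha>: "\<alpha> \<in> Cell \<kappa>" "\<alpha>' \<in> Cell \<kappa>" "\<alpha> \<noteq> \<alpha>'"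
  shows "real (card {B\<in>Shears m. hits m \<Theta> \<alpha> B \<and> hits m \<Theta> \<alpha>' B}) \<le> (256 / \<delta> * \<eta>\<^sup>2 * real P ^ d) ^ m"
proof -
  have "{B\<in>Shears m. hits m \<Theta> \<alpha> B \<and> hits m \<Theta> \<alpha>' B} \<subseteq> {B\<in>Shears m. \<forall>j<m.
      near UNIV \<eta> (\<Theta> \<alpha> j - \<delta> / P * lin d \<alpha> (B j)) \<and> near UNIV \<eta> (\<Theta> \<alpha>' j - \<delta> / P * lin d \<alpha>' (B j))}"
    unfolding hits_def using near_mono[OF _ subset_UNIV] by blast
  then have "real (card {B\<in>Shears m. hits m \<Theta> \<alpha> B \<and> hits m \<Theta> \<alpha>' B}) \<le> real (card {B\<in>Shears m. \<forall>j<m.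
      near UNIV \<eta> (\<Theta> \<alpha> j - \<delta> / P * lin d \<alpha> (B j)) \<and> near UNIV \<eta> (\<Theta> \<alpha>' j - \<delta> / P * lin d \<alpha>' (B j))})"
    by (intro of_nat_mono card_mono) auto
  also have "\<dots> = (\<Prod>j<m. real (card {b\<in>Row.
      near UNIV \<eta> (\<Theta> \<alpha> j - \<delta> / P * lin d \<alpha> b) \<and> near UNIV \<eta> (\<Theta> \<alpha>' j - \<delta> / P * lin d \<alpha>' b)}))"
    by (rule card_Shears_rowwise)
  also have "\<dots> \<le> (\<Prod>j<m. 256 / \<delta> * \<eta>\<^sup>2 * real P ^ d)"
    using card_row_pair_le[OF \<kappa> \<alpha>] by (intro prod_mono) auto
  finally show ?thesis by simp
qed

lemma cell_hit_ge:
  assumes \<kappa>: "\<kappa> \<in> Cells" and m: "m \<ge> 1"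
  shows "real (card (Shears m)) * ((width / 4) ^ d * (\<eta> / 128) ^ m - (width ^ d * \<eta> ^ m)\<^sup>2 * (256 / \<delta>) ^ m)
     \<le> real (card {B\<in>Shears m. \<exists>\<alpha>\<in>Cell \<kappa>. hits m \<Theta> \<alpha> B})"
proof -
  define T where "T = (real P ^ d) ^ m"
  have "(\<Sum>\<alpha>\<in>Cell \<kappa>. real (card {B\<in>Shears m. hits m \<Theta> \<alpha> B})) -
      (\<Sum>\<alpha>\<in>Cell \<kappa>. \<Sum>\<alpha>'\<in>Cell \<kappa> - {\<alpha>}. real (card {B\<in>Shears m. hits m \<Theta> \<alpha> B \<and> hits m \<Theta> \<alpha>' B}))
    = (\<Sum>B\<in>Shears m. (\<Sum>\<alpha>\<in>Cell \<kappa>. of_bool (hits m \<Theta> \<alpha> B)) -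
      (\<Sum>\<alpha>\<in>Cell \<kappa>. \<Sum>\<alpha>'\<in>Cell \<kappa> - {\<alpha>}. of_bool (hits m \<Theta> \<alpha> B \<and> hits m \<Theta> \<alpha>' B)))"
    unfolding real_card_Collect[OF finite_Shears] sum_subtractf sum.swap[of _ "Shears m"] by (rule refl)
  also have "\<dots> \<le> (\<Sum>B\<in>Shears m. of_bool (\<exists>\<alpha>\<in>Cell \<kappa>. hits m \<Theta> \<alpha> B))"
    by (intro sum_mono of_bool_ex_ge) simp
  also have "\<dots> = real (card {B\<in>Shears m. \<exists>\<alpha>\<in>Cell \<kappa>. hits m \<Theta> \<alpha> B})"
    by (rule real_card_Collect[symmetric]) simp
  finally have 1: "(\<Sum>\<alpha>\<in>Cell \<kappa>. real (card {B\<in>Shears m. hits m \<Theta> \<alpha> B})) -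
      (\<Sum>\<alpha>\<in>Cell \<kappa>. \<Sum>\<alpha>'\<in>Cell \<kappa> - {\<alpha>}. real (card {B\<in>Shears m. hits m \<Theta> \<alpha> B \<and> hits m \<Theta> \<alpha>' B}))
      \<le> real (card {B\<in>Shears m. \<exists>\<alpha>\<in>Cell \<kappa>. hits m \<Theta> \<alpha> B})" .
  have w0: "width \<ge> 0" using width_bounds by simp
  have "(width / 4) ^ d * (\<eta> * real P ^ d / 128) ^ m \<le> real (card (Cell \<kappa>)) * (\<eta> * real P ^ d / 128) ^ m"
    using card_Cell eta by (intro mult_right_mono) auto
  also have "\<dots> \<le> (\<Sum>\<alpha>\<in>Cell \<kappa>. real (card {B\<in>Shears m. hits m \<Theta> \<alpha> B}))"
    by (rule first_moment_ge[OF \<kappa> m])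
  finally have 2: "(width / 4) ^ d * (\<eta> * real P ^ d / 128) ^ m \<le> \<dots>" .
  define U where "U = (256 / \<delta> * \<eta>\<^sup>2 * real P ^ d) ^ m"
  have U0: "U \<ge> 0" using delta by (simp add: U_def)
  have "(\<Sum>\<alpha>\<in>Cell \<kappa>. \<Sum>\<alpha>'\<in>Cell \<kappa> - {\<alpha>}. real (card {B\<in>Shears m. hits m \<Theta> \<alpha> B \<and> hits m \<Theta> \<alpha>' B}))
      \<le> (\<Sum>\<alpha>\<in>Cell \<kappa>. \<Sum>\<alpha>'\<in>Cell \<kappa> - {\<alpha>}. U)"
    unfolding U_def by (intro sum_mono pair_le[OF \<kappa>]) auto
  also have "\<dots> \<le> (\<Sum>\<alpha>\<in>Cell \<kappa>. \<Sum>\<alpha>'\<in>Cell \<kappa>. U)"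
    using U0 by (intro sum_mono sum_mono2) auto
  also have "\<dots> = real (card (Cell \<kappa>)) * real (card (Cell \<kappa>)) * U" by simp
  also have "\<dots> \<le> width ^ d * width ^ d * U"
    using card_Cell U0 w0 by (intro mult_right_mono mult_mono) auto
  finally have 3: "(\<Sum>\<alpha>\<in>Cell \<kappa>. \<Sum>\<alpha>'\<in>Cell \<kappa> - {\<alpha>}. real (card {B\<in>Shears m. hits m \<Theta> \<alpha> B \<and> hits m \<Theta> \<alpha>' B}))
      \<le> width ^ d * width ^ d * U" .
  have e1: "(\<eta> * real P ^ d / 128) ^ m = T * (\<eta> / 128) ^ m"
    by (simp add: T_def power_mult_distrib power_divide)
  have "U = (256 / \<delta>) ^ m * (\<eta> ^ 2) ^ m * T"
    unfolding U_def T_def power_mult_distrib by simp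
  also have "(\<eta> ^ 2) ^ m = \<eta> ^ m * \<eta> ^ m" by (simp add: power2_eq_square power_mult_distrib)
  finally have e2: "width ^ d * width ^ d * U = T * ((width ^ d * \<eta> ^ m)\<^sup>2 * (256 / \<delta>) ^ m)"
    by (simp add: power2_eq_square)
  show ?thesis using 1 2 3 unfolding e1 e2 card_Shears T_def[symmetric] right_diff_distrib
    by (simp add: mult.left_commute)
qed

text \<open>Some shear does at least as well as the average.\<close>

lemma exists_good_shear:
  assumes m: "m \<ge> 1" and c: "c = (width / 4) ^ d * (\<eta> / 128) ^ m - (width ^ d * \<eta> ^ m)\<^sup>2 * (256 / \<delta>) ^ m"
  obtains B where "B \<in> Shears m"
    "real (card Cells) * c \<le> real (card {\<kappa>\<in>Cells. \<exists>\<alpha>\<in>Cell \<kappa>. hits m \<Theta> \<alpha> B})"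
proof -
  let ?h = "\<lambda>\<kappa> B. \<exists>\<alpha>\<in>Cell \<kappa>. hits m \<Theta> \<alpha> B"
  have "(\<Sum>B\<in>Shears m. real (card Cells) * c) = (\<Sum>\<kappa>\<in>Cells. real (card (Shears m)) * c)"
    by simp
  also have "\<dots> \<le> (\<Sum>\<kappa>\<in>Cells. real (card {B\<in>Shears m. ?h \<kappa> B}))"
    unfolding c by (intro sum_mono cell_hit_ge m)
  also have "\<dots> = (\<Sum>B\<in>Shears m. real (card {\<kappa>\<in>Cells. ?h \<kappa> B}))"
    unfolding real_card_Collect[OF finite_Shears] real_card_Collect[OF finite_Cells] by (rule sum.swap)
  finally have le: "(\<Sum>B\<in>Shears m. real (card Cells) * c) \<le> (\<Sum>B\<in>Shears m. real (card {\<kappa>\<in>Cells. ?h \<kappa> B}))" .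
  have "\<exists>B\<in>Shears m. real (card Cells) * c \<le> real (card {\<kappa>\<in>Cells. ?h \<kappa> B})"
  proof (rule ccontr)
    assume "\<not> ?thesis"
    then have "(\<Sum>B\<in>Shears m. real (card {\<kappa>\<in>Cells. ?h \<kappa> B})) < (\<Sum>B\<in>Shears m. real (card Cells) * c)"
      using Shears_nonempty by (intro sum_strict_mono) (auto simp: not_le)
    with le show False by simp
  qed
  then show thesis using that by blast
qed

end

section \<open>A twice differentiable cutoff function\<close>

lemma has_derivative_max_0_power:
  assumes "k \<ge> 1"
  shows "((\<lambda>t::real. max 0 t ^ Suc k) has_real_derivative real (Suc k) * max 0 t ^ k) (at t)"
proof -
  consider "t > 0" | "t < 0" | "t = 0" by linarith
  then show ?thesis
  proof cases
    case 1
    have "((\<lambda>t::real. t ^ Suc k) has_real_derivative real (Suc k) * t ^ k) (at t)"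
      using DERIV_pow[of "Suc k" t UNIV] by simp
    then have "((\<lambda>t::real. max 0 t ^ Suc k) has_real_derivative real (Suc k) * t ^ k) (at t)"
      by (rule has_field_derivative_transform_within_open[of _ _ _ "{0<..}"]) (use 1 in auto)
    then show ?thesis using 1 by simp
  next
    case 2
    have "((\<lambda>t::real. 0) has_real_derivative 0) (at t)" by simp
    then have "((\<lambda>t::real. max 0 t ^ Suc k) has_real_derivative 0) (at t)"
      by (rule has_field_derivative_transform_within_open[of _ _ _ "{..<0}"]) (use 2 in auto)
    moreover have "real (Suc k) * max 0 t ^ k = 0" using 2 assms by (simp add: power_0_left)
    ultimately show ?thesis by (simp only:)
  next
    case 3
    have "isCont (\<lambda>h::real. max 0 h ^ k) 0" by (intro continuous_intros)
    moreover have "max 0 (0::real) ^ k = 0" using assms by (simp add: power_0_left)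
    ultimately have "((\<lambda>h::real. max 0 h ^ k) \<longlongrightarrow> 0) (at 0)"
      unfolding isCont_def by (simp only:)
    then have "((\<lambda>h::real. (max 0 (0 + h) ^ Suc k - max 0 0 ^ Suc k) / h) \<longlongrightarrow> 0) (at 0)"
    proof (rule Lim_transform_eventually)
      have "max 0 h ^ k = (max 0 (0 + h) ^ Suc k - max 0 0 ^ Suc k) / h" if "h \<noteq> 0" for h :: real
        using that assms by (cases "h > 0") auto
      then show "\<forall>\<^sub>F h::real in at 0. max 0 h ^ k = (max 0 (0 + h) ^ Suc k - max 0 0 ^ Suc k) / h"
        by (auto simp: eventually_at_filter)
    qed
    moreover have "real (Suc k) * max 0 t ^ k = 0" using 3 assms by (simp add: power_0_left)
    ultimately show ?thesis unfolding DERIV_def by (simp only: 3)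
  qed
qed

text \<open>\<open>cutoff a\<close>, for \<open>a \<le> 2\<close>, is the \<open>a\<close>-th derivative of the function \<open>t\<^sup>3 (1 - t)\<^sup>3\<close> on
  \<open>[0,1]\<close>, extended by zero to the real line.\<close>

definition cutoff :: "nat \<Rightarrow> real \<Rightarrow> real" where
  "cutoff a t =
    (if a = 0 then max 0 t ^ 3 * max 0 (1 - t) ^ 3
     else if a = 1 then 3 * max 0 t ^ 2 * max 0 (1 - t) ^ 3 - 3 * max 0 t ^ 3 * max 0 (1 - t) ^ 2
     else 6 * max 0 t ^ 1 * max 0 (1 - t) ^ 3 - 18 * max 0 t ^ 2 * max 0 (1 - t) ^ 2
        + 6 * max 0 t ^ 3 * max 0 (1 - t) ^ 1)"

lemma cutoff_outside: "t \<le> 0 \<or> 1 \<le> t \<Longrightarrow> cutoff a t = 0"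
  by (auto simp: cutoff_def max_def)

lemma continuous_on_cutoff: "continuous_on UNIV (cutoff a)"
proof -
  consider "a = 0" | "a = 1" | "a \<ge> 2" by linarith
  then show ?thesis
  proof cases
    case 1
    then have "cutoff a = (\<lambda>t. max 0 t ^ 3 * max 0 (1 - t) ^ 3)" by (auto simp: cutoff_def)
    then show ?thesis by (simp only:) (intro continuous_intros)
  next
    case 2
    then have "cutoff a = (\<lambda>t. 3 * max 0 t ^ 2 * max 0 (1 - t) ^ 3 - 3 * max 0 t ^ 3 * max 0 (1 - t) ^ 2)"
      by (auto simp: cutoff_def)
    then show ?thesis by (simp only:) (intro continuous_intros)
  next
    case 3
    then have "cutoff a = (\<lambda>t. 6 * max 0 t ^ 1 * max 0 (1 - t) ^ 3 - 18 * max 0 t ^ 2 * max 0 (1 - t) ^ 2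
        + 6 * max 0 t ^ 3 * max 0 (1 - t) ^ 1)"
      by (auto simp: cutoff_def)
    then show ?thesis by (simp only:) (intro continuous_intros)
  qed
qed

lemma cutoff_has_derivative:
  assumes "a < 2"
  shows "(cutoff a has_real_derivative cutoff (Suc a) t) (at t)"
proof -
  have p: "((\<lambda>t::real. max 0 t ^ 3) has_real_derivative 3 * max 0 t ^ 2) (at t)"
    "((\<lambda>t::real. max 0 t ^ 2) has_real_derivative 2 * max 0 t ^ 1) (at t)" for t
    using has_derivative_max_0_power[of 2 t] has_derivative_max_0_power[of 1 t]
    by (simp_all add: numeral_3_eq_3 numeral_2_eq_2)
  have q: "((\<lambda>t::real. max 0 (1 - t) ^ 3) has_real_derivative - (3 * max 0 (1 - t) ^ 2)) (at t)"
    "((\<lambda>t::real. max 0 (1 - t) ^ 2) has_real_derivative - (2 * max 0 (1 - t) ^ 1)) (at t)" for t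
  proof -
    have *: "((\<lambda>t::real. 1 - t) has_real_derivative -1) (at t)"
      by (auto intro!: derivative_eq_intros)
    show "((\<lambda>t::real. max 0 (1 - t) ^ 3) has_real_derivative - (3 * max 0 (1 - t) ^ 2)) (at t)"
      using DERIV_chain2[OF p(1) *] by simp
    show "((\<lambda>t::real. max 0 (1 - t) ^ 2) has_real_derivative - (2 * max 0 (1 - t) ^ 1)) (at t)"
      using DERIV_chain2[OF p(2) *] by simp
  qed
  consider "a = 0" | "a = 1" using assms by linarith
  then show ?thesis
  proof cases
    case 1
    then have "cutoff a = (\<lambda>t. max 0 t ^ 3 * max 0 (1 - t) ^ 3)" by (auto simp: cutoff_def)
    moreover have "((\<lambda>t. max 0 t ^ 3 * max 0 (1 - t) ^ 3) has_real_derivative cutoff (Suc a) t) (at t)"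
      by (rule derivative_eq_intros p q refl)+ (use 1 in \<open>simp add: cutoff_def algebra_simps\<close>)
    ultimately show ?thesis by (simp only:)
  next
    case 2
    then have "cutoff a = (\<lambda>t. 3 * max 0 t ^ 2 * max 0 (1 - t) ^ 3 - 3 * max 0 t ^ 3 * max 0 (1 - t) ^ 2)"
      by (auto simp: cutoff_def)
    moreover have "((\<lambda>t. 3 * max 0 t ^ 2 * max 0 (1 - t) ^ 3 - 3 * max 0 t ^ 3 * max 0 (1 - t) ^ 2)
        has_real_derivative cutoff (Suc a) t) (at t)"
      by (rule derivative_eq_intros p q refl)+ (use 2 in \<open>simp add: cutoff_def algebra_simps\<close>)
    ultimately show ?thesis by (simp only:)
  qed
qed

lemma abs_cutoff_le:
  assumes "a \<le> 2"
  shows "\<bar>cutoff a t\<bar> \<le> 30 ^ a"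
proof (cases "0 < t \<and> t < 1")
  case False
  then show ?thesis by (subst cutoff_outside) auto
next
  case True
  define p where "p i j = t ^ i * (1 - t) ^ j" for i j :: nat
  have p: "0 \<le> p i j" "p i j \<le> 1" for i j
    unfolding p_def using True by (auto intro!: mult_le_one power_le_one)
  have m: "max 0 t = t" "max 0 (1 - t) = 1 - t" using True by auto
  consider "a = 0" | "a = 1" | "a = 2" using assms by linarith
  then show ?thesis
  proof cases
    case 1
    then have "cutoff a t = p 3 3" unfolding cutoff_def m p_def by simp
    then show ?thesis using p[of 3 3] 1 by simp
  next
    case 2
    then have "cutoff a t = 3 * p 2 3 - 3 * p 3 2" unfolding cutoff_def m p_def by simp
    then show ?thesis using p[of 2 3] p[of 3 2] 2 by (simp add: abs_le_iff)
  next
    case 3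
    then have "cutoff a t = 6 * p 1 3 - 18 * p 2 2 + 6 * p 3 1" unfolding cutoff_def m p_def by simp
    then show ?thesis using p[of 1 3] p[of 2 2] p[of 3 1] 3 by (simp add: abs_le_iff)
  qed
qed

lemma cutoff_0_ge:
  assumes "1 / 4 \<le> t" "t \<le> 3 / 4"
  shows "1 / 4096 \<le> cutoff 0 t"
proof -
  have "(1 / 4) ^ 3 * (1 / 4) ^ 3 \<le> t ^ 3 * (1 - t) ^ 3"
    using assms by (intro mult_mono power_mono) auto
  then show ?thesis using assms by (simp add: cutoff_def power3_eq_cube)
qed

section \<open>Calculus on the cube\<close>

lemma unit_cube_upd: "x \<in> unit_cube d \<Longrightarrow> i < d \<Longrightarrow> t \<in> {0..1} \<Longrightarrow> x(i := t) \<in> unit_cube d"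
  by (auto simp: unit_cube_def PiE_iff extensional_def)

lemma unit_cube_coord: "x \<in> unit_cube d \<Longrightarrow> i < d \<Longrightarrow> x i \<in> {0..1}"
  by (auto simp: unit_cube_def PiE_iff)

lemma unit_cube_nonempty: "unit_cube d \<noteq> {}"
  unfolding unit_cube_def by (simp add: PiE_eq_empty_iff)

lemma partial_deriv_eqI:
  assumes "x \<in> unit_cube d" "i < d"
    and "((\<lambda>t. f (x(i := t))) has_vector_derivative D) (at (x i) within {0..1})"
  shows "partial_deriv i f x = D"
  unfolding partial_deriv_def
  using vector_derivative_within_cbox[of 0 1 "x i" "\<lambda>t. f (x(i := t))" D] unit_cube_coord[OF assms(1,2)] assms(3)
  by simp

lemma partial_deriv_cong:
  assumes "\<And>x. x \<in> unit_cube d \<Longrightarrow> f x = g x" "x \<in> unit_cube d" "i < d"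
  shows "partial_deriv i f x = partial_deriv i g x"
proof -
  have "((\<lambda>t. f (x(i := t))) has_vector_derivative D) (at (x i) within {0..1}) \<longleftrightarrow>
        ((\<lambda>t. g (x(i := t))) has_vector_derivative D) (at (x i) within {0..1})" for D
    using unit_cube_coord[OF assms(2,3)] unit_cube_upd[OF assms(2,3)] assms(1)
    by (auto elim!: has_vector_derivative_transform[rotated 2])
  then show ?thesis by (simp add: partial_deriv_def vector_derivative_def)
qed

lemma Ck_cube_cong:
  assumes "\<And>x. x \<in> unit_cube d \<Longrightarrow> f x = g x" "Ck_cube d k f"
  shows "Ck_cube d k g"
  using assms
proof (induction k arbitrary: f g)
  case 0
  then show ?case by (simp cong: continuous_on_cong)
next
  case (Suc k)
  have "(\<lambda>t. g (x(i := t))) differentiable (at (x i) within {0..1})" if "i < d" "x \<in> unit_cube d" for i x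
  proof (rule differentiable_transform_within[where d = 1])
    show "(\<lambda>t. f (x(i := t))) differentiable (at (x i) within {0..1})"
      using Suc.prems(2) that by simp
  qed (use Suc.prems(1) unit_cube_upd[OF that(2,1)] unit_cube_coord[OF that(2,1)] in auto)
  moreover have "Ck_cube d k (partial_deriv i g)" if "i < d" for i
    using Suc.IH[of "partial_deriv i f" "partial_deriv i g"] Suc.prems(2) that
      partial_deriv_cong[OF Suc.prems(1)] by auto
  moreover have "continuous_on (unit_cube d) g"
    using Suc.prems by (simp cong: continuous_on_cong)
  ultimately show ?case by simp
qed

lemma Ck_cube_add:
  assumes "Ck_cube d k f" "Ck_cube d k g"
  shows "Ck_cube d k (\<lambda>x. f x + g x)"
  using assms
proof (induction k arbitrary: f g)
  case 0
  then show ?case by (simp add: continuous_on_add)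
next
  case (Suc k)
  have "Ck_cube d k (partial_deriv i (\<lambda>x. f x + g x))" if i: "i < d" for i
  proof (rule Ck_cube_cong)
    show "Ck_cube d k (\<lambda>x. partial_deriv i f x + partial_deriv i g x)"
      using Suc that by simp
    fix x assume x: "x \<in> unit_cube d"
    have "((\<lambda>t. f (x(i := t))) has_vector_derivative partial_deriv i f x) (at (x i) within {0..1})"
         "((\<lambda>t. g (x(i := t))) has_vector_derivative partial_deriv i g x) (at (x i) within {0..1})"
      unfolding partial_deriv_def using Suc.prems x i by (simp_all flip: vector_derivative_works)
    then have "((\<lambda>t. f (x(i := t)) + g (x(i := t))) has_vector_derivative
        partial_deriv i f x + partial_deriv i g x) (at (x i) within {0..1})"
      by (rule has_vector_derivative_add)
    from partial_deriv_eqI[OF x i this]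
    show "partial_deriv i f x + partial_deriv i g x = partial_deriv i (\<lambda>x. f x + g x) x" by simp
  qed
  then show ?case using Suc.prems by (simp add: continuous_on_add)
qed

section \<open>Bumps on a grid of cells\<close>

text \<open>The cells are the cubes of side length \<open>1 / k\<close> with corners \<open>\<kappa> / k\<close>, and \<open>bumps d k H c (\<lambda>_. 0)\<close> is
  the sum of bumps of height proportional to \<open>c \<kappa>\<close> on the cells \<open>\<kappa> \<in> H\<close>. The multi-index \<open>\<alpha>\<close> selects the
  partial derivative.\<close>

definition bumps :: "nat \<Rightarrow> real \<Rightarrow> (nat \<Rightarrow> nat) set \<Rightarrow> ((nat \<Rightarrow> nat) \<Rightarrow> real) \<Rightarrow> (nat \<Rightarrow> nat) \<Rightarrow> (nat \<Rightarrow> real) \<Rightarrow> real" where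
  "bumps d k H c \<alpha> x = (\<Sum>\<kappa>\<in>H. c \<kappa> * (\<Prod>i<d. k ^ \<alpha> i * cutoff (\<alpha> i) (k * x i - real (\<kappa> i))))"

lemma bumps_has_derivative:
  assumes i: "i < d" "\<alpha> i < 2"
  shows "((\<lambda>t. bumps d k H c \<alpha> (x(i := t))) has_real_derivative bumps d k H c (\<alpha>(i := Suc (\<alpha> i))) (x(i := t)))
    (at t within S)"
proof -
  define r where "r \<kappa> = (\<Prod>l\<in>{..<d} - {i}. k ^ \<alpha> l * cutoff (\<alpha> l) (k * x l - real (\<kappa> l)))" for \<kappa> :: "nat \<Rightarrow> nat"
  have eq: "(\<Prod>l<d. k ^ \<beta> l * cutoff (\<beta> l) (k * (x(i := t)) l - real (\<kappa> l))) =
      k ^ \<beta> i * cutoff (\<beta> i) (k * t - real (\<kappa> i)) * r \<kappa>" if "\<And>l. l \<noteq> i \<Longrightarrow> \<beta> l = \<alpha> l" for \<beta> t \<kappa>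
  proof -
    have "(\<Prod>l<d. k ^ \<beta> l * cutoff (\<beta> l) (k * (x(i := t)) l - real (\<kappa> l))) =
       (k ^ \<beta> i * cutoff (\<beta> i) (k * t - real (\<kappa> i))) *
       (\<Prod>l\<in>{..<d} - {i}. k ^ \<beta> l * cutoff (\<beta> l) (k * (x(i := t)) l - real (\<kappa> l)))"
      using i by (subst prod.remove[of _ i]) auto
    also have "(\<Prod>l\<in>{..<d} - {i}. k ^ \<beta> l * cutoff (\<beta> l) (k * (x(i := t)) l - real (\<kappa> l))) = r \<kappa>"
      unfolding r_def using that by (intro prod.cong) auto
    finally show ?thesis .
  qed
  have cut: "((\<lambda>t. cutoff (\<alpha> i) (k * t - real (\<kappa> i))) has_real_derivative
      cutoff (Suc (\<alpha> i)) (k * t - real (\<kappa> i)) * k) (at t within S)" for \<kappa> :: "nat \<Rightarrow> nat"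
    by (rule DERIV_chain2[OF cutoff_has_derivative[OF i(2)]]) (auto intro!: derivative_eq_intros)
  have "((\<lambda>t. \<Sum>\<kappa>\<in>H. c \<kappa> * (k ^ \<alpha> i * cutoff (\<alpha> i) (k * t - real (\<kappa> i)) * r \<kappa>)) has_real_derivative
     (\<Sum>\<kappa>\<in>H. c \<kappa> * (k ^ Suc (\<alpha> i) * cutoff (Suc (\<alpha> i)) (k * t - real (\<kappa> i)) * r \<kappa>))) (at t within S)"
    by (auto intro!: derivative_eq_intros cut sum.cong)
  then show ?thesis unfolding bumps_def eq[of \<alpha>, OF refl] by (subst eq) auto
qed

lemma partial_deriv_bumps:
  assumes "x \<in> unit_cube d" "i < d" "\<alpha> i < 2"
  shows "partial_deriv i (bumps d k H c \<alpha>) x = bumps d k H c (\<alpha>(i := Suc (\<alpha> i))) x"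
  using bumps_has_derivative[where \<alpha> = \<alpha>, OF assms(2,3), of k H c x "x i" "{0..1}"]
  by (intro partial_deriv_eqI[OF assms(1,2)]) (simp add: has_real_derivative_iff_has_vector_derivative)

lemma continuous_on_bumps: "continuous_on A (bumps d k H c \<alpha>)"
proof -
  have "continuous_on A (\<lambda>x. cutoff a (k * x i - b))" for a i b
    by (rule continuous_on_compose2[OF continuous_on_cutoff])
      (auto intro!: continuous_intros continuous_on_subset[OF continuous_on_product_coordinates])
  then show ?thesis unfolding bumps_def[abs_def] by (intro continuous_intros)
qed

lemma Ck_cube_bumps:
  assumes "\<And>i. i < d \<Longrightarrow> \<alpha> i + k \<le> 2"
  shows "Ck_cube d k (bumps d K H c \<alpha>)"
  using assms
proof (induction k arbitrary: \<alpha>)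
  case 0
  show ?case by (simp add: continuous_on_bumps)
next
  case (Suc k)
  have "(\<lambda>t. bumps d K H c \<alpha> (x(i := t))) differentiable (at (x i) within {0..1})" if "i < d" for i x
    using bumps_has_derivative[of i d \<alpha> K H c x "x i" "{0..1}"] Suc.prems[OF that] that
    by (auto simp: real_differentiable_def)
  moreover have "Ck_cube d k (partial_deriv i (bumps d K H c \<alpha>))" if "i < d" for i
  proof (rule Ck_cube_cong)
    have le: "(\<alpha>(i := Suc (\<alpha> i))) l + k \<le> 2" if "l < d" for l using Suc.prems[OF that] by auto
    show "Ck_cube d k (bumps d K H c (\<alpha>(i := Suc (\<alpha> i))))" by (rule Suc.IH[OF le])
    show "bumps d K H c (\<alpha>(i := Suc (\<alpha> i))) x = partial_deriv i (bumps d K H c \<alpha>) x" if "x \<in> unit_cube d" for x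
      using partial_deriv_bumps[OF that \<open>i < d\<close>] Suc.prems[OF \<open>i < d\<close>] by simp
  qed
  ultimately show ?case by (simp add: continuous_on_bumps)
qed

text \<open>Partial derivatives at points outside the cube are unspecified, so iterated derivatives are only
  computed on the cube.\<close>

lemma partial_deriv_power_bumps:
  assumes "\<And>x. x \<in> unit_cube d \<Longrightarrow> f x = bumps d k H c \<alpha> x" "i < d" "\<alpha> i = 0" "a \<le> 2" "x \<in> unit_cube d"
  shows "(partial_deriv i ^^ a) f x = bumps d k H c (\<alpha>(i := a)) x"
  using assms(4,5)
proof (induction a arbitrary: x)
  case 0
  have "\<alpha>(i := 0) = \<alpha>" using assms(3) by auto
  then show ?case using 0 assms(1) by simp
next
  case (Suc a)
  have "partial_deriv i ((partial_deriv i ^^ a) f) x = partial_deriv i (bumps d k H c (\<alpha>(i := a))) x"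
    using Suc.IH Suc.prems by (intro partial_deriv_cong[OF _ Suc.prems(2) assms(2)]) (simp del: fun_upd_apply)
  also have "\<dots> = bumps d k H c (\<alpha>(i := Suc a)) x"
    using Suc.prems assms(2) by (subst partial_deriv_bumps) auto
  finally show ?case unfolding funpow.simps comp_apply .
qed

lemma multi_deriv_bumps:
  assumes "\<alpha> \<in> multi_indices d 2" "x \<in> unit_cube d"
  shows "multi_deriv d \<alpha> (bumps d k H c (\<lambda>_. 0)) x = bumps d k H c \<alpha> x"
proof -
  have a2: "\<alpha> i \<le> 2" if "i < d" for i
  proof -
    have "\<alpha> i \<le> (\<Sum>i<d. \<alpha> i)" using that by (intro member_le_sum) auto
    then show ?thesis using assms(1) by (auto simp: multi_indices_def)
  qed
  have "foldr (\<lambda>i. partial_deriv i ^^ \<alpha> i) [l..<d] (bumps d k H c (\<lambda>_. 0)) x =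
      bumps d k H c (\<lambda>i. if l \<le> i \<and> i < d then \<alpha> i else 0) x" if "l \<le> d" "x \<in> unit_cube d" for l x
    using that
  proof (induction l arbitrary: x rule: inc_induct)
    case base
    have "(\<lambda>i. if d \<le> i \<and> i < d then \<alpha> i else 0) = (\<lambda>_. 0)" by auto
    then show ?case by simp
  next
    case (step l)
    have upd: "(\<lambda>i. if Suc l \<le> i \<and> i < d then \<alpha> i else 0)(l := \<alpha> l) = (\<lambda>i. if l \<le> i \<and> i < d then \<alpha> i else 0)"
      using step.hyps by (auto simp: fun_eq_iff)
    have "foldr (\<lambda>i. partial_deriv i ^^ \<alpha> i) [l..<d] (bumps d k H c (\<lambda>_. 0)) x =
        (partial_deriv l ^^ \<alpha> l) (foldr (\<lambda>i. partial_deriv i ^^ \<alpha> i) [Suc l..<d] (bumps d k H c (\<lambda>_. 0))) x"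
      using step.hyps by (simp add: upt_conv_Cons)
    also have "\<dots> = bumps d k H c ((\<lambda>i. if Suc l \<le> i \<and> i < d then \<alpha> i else 0)(l := \<alpha> l)) x"
      using step.IH step.hyps step.prems a2 by (intro partial_deriv_power_bumps) auto
    finally show ?case unfolding upd .
  qed
  from this[of 0 x] assms(2)
  have "multi_deriv d \<alpha> (bumps d k H c (\<lambda>_. 0)) x = bumps d k H c (\<lambda>i. if 0 \<le> i \<and> i < d then \<alpha> i else 0) x"
    by (simp add: multi_deriv_def)
  moreover have "(\<lambda>i. if 0 \<le> i \<and> i < d then \<alpha> i else 0) = \<alpha>"
    using assms(1) by (auto simp: multi_indices_def fun_eq_iff)
  ultimately show ?thesis by simp
qed

lemma abs_sum_disjoint_le:
  fixes f :: "'a \<Rightarrow> real"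
  assumes "\<And>x. x \<in> H \<Longrightarrow> \<bar>f x\<bar> \<le> M" "M \<ge> 0"
    and "\<And>x y. x \<in> H \<Longrightarrow> y \<in> H \<Longrightarrow> f x \<noteq> 0 \<Longrightarrow> f y \<noteq> 0 \<Longrightarrow> x = y"
  shows "\<bar>sum f H\<bar> \<le> M"
proof (cases "\<exists>x\<in>H. f x \<noteq> 0")
  case True
  then obtain x where x: "x \<in> H" "f x \<noteq> 0" by blast
  show ?thesis
  proof (cases "finite H")
    case True
    have "sum f H = f x + sum f (H - {x})" using True x by (intro sum.remove) auto
    also have "sum f (H - {x}) = 0" using assms(3) x by (intro sum.neutral) blast
    finally show ?thesis using assms(1)[OF x(1)] by simp
  qed (use assms in simp)
next
  case False
  then have "sum f H = 0" by (intro sum.neutral) blast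
  then show ?thesis using assms by simp
qed

lemma cutoff_cells_disjoint:
  assumes "cutoff a (t - real k) \<noteq> 0" "cutoff b (t - real l) \<noteq> 0"
  shows "k = l"
proof -
  have "real k < t" "t < real k + 1" "real l < t" "t < real l + 1"
    using assms cutoff_outside[of "t - real k" a] cutoff_outside[of "t - real l" b] by linarith+
  then show ?thesis by linarith
qed

lemma abs_bumps_le:
  assumes H: "H \<subseteq> PiE {..<d} (\<lambda>_. UNIV)" and k: "k \<ge> 1" and c: "\<And>\<kappa>. \<kappa> \<in> H \<Longrightarrow> \<bar>c \<kappa>\<bar> \<le> M" and M: "M \<ge> 0"
    and \<alpha>: "\<alpha> \<in> multi_indices d 2"
  shows "\<bar>bumps d k H c \<alpha> x\<bar> \<le> M * (900 * k\<^sup>2)"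
  unfolding bumps_def
proof (rule abs_sum_disjoint_le)
  have sum2: "(\<Sum>i<d. \<alpha> i) \<le> 2" using \<alpha> by (simp add: multi_indices_def)
  have a2: "\<alpha> i \<le> 2" if "i < d" for i
  proof -
    have "\<alpha> i \<le> (\<Sum>i<d. \<alpha> i)" using that by (intro member_le_sum) auto
    then show ?thesis using sum2 by simp
  qed
  fix \<kappa> assume \<kappa>: "\<kappa> \<in> H"
  have "\<bar>\<Prod>i<d. k ^ \<alpha> i * cutoff (\<alpha> i) (k * x i - real (\<kappa> i))\<bar> \<le> (\<Prod>i<d. (30 * k) ^ \<alpha> i)"
    unfolding abs_prod
  proof (intro prod_mono conjI)
    fix i assume "i \<in> {..<d}"
    have "\<bar>k ^ \<alpha> i * cutoff (\<alpha> i) (k * x i - real (\<kappa> i))\<bar> = k ^ \<alpha> i * \<bar>cutoff (\<alpha> i) (k * x i - real (\<kappa> i))\<bar>"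
      using k by (simp add: abs_mult)
    also have "\<dots> \<le> k ^ \<alpha> i * 30 ^ \<alpha> i"
      using k a2 \<open>i \<in> {..<d}\<close> by (intro mult_left_mono abs_cutoff_le) auto
    finally show "\<bar>k ^ \<alpha> i * cutoff (\<alpha> i) (k * x i - real (\<kappa> i))\<bar> \<le> (30 * k) ^ \<alpha> i"
      by (simp add: power_mult_distrib mult.commute)
  qed simp
  also have "\<dots> = (30 * k) ^ (\<Sum>i<d. \<alpha> i)" by (rule power_sum[symmetric])
  also have "\<dots> \<le> (30 * k) ^ 2" using k sum2 by (intro power_increasing) auto
  finally have "\<bar>\<Prod>i<d. k ^ \<alpha> i * cutoff (\<alpha> i) (k * x i - real (\<kappa> i))\<bar> \<le> 900 * k\<^sup>2"
    by (simp add: power_mult_distrib)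
  then show "\<bar>c \<kappa> * (\<Prod>i<d. k ^ \<alpha> i * cutoff (\<alpha> i) (k * x i - real (\<kappa> i)))\<bar> \<le> M * (900 * k\<^sup>2)"
    unfolding abs_mult using c[OF \<kappa>] M by (intro mult_mono) auto
next
  fix \<kappa> \<kappa>' assume in_H: "\<kappa> \<in> H" "\<kappa>' \<in> H"
    and "c \<kappa> * (\<Prod>i<d. k ^ \<alpha> i * cutoff (\<alpha> i) (k * x i - real (\<kappa> i))) \<noteq> 0"
        "c \<kappa>' * (\<Prod>i<d. k ^ \<alpha> i * cutoff (\<alpha> i) (k * x i - real (\<kappa>' i))) \<noteq> 0"
  then have "\<kappa> i = \<kappa>' i" if "i < d" for i
    using that by (intro cutoff_cells_disjoint[of "\<alpha> i" "k * x i" _ "\<alpha> i"]) (auto simp: prod_zero_iff)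
  then show "\<kappa> = \<kappa>'" using H in_H by (intro PiE_ext[of \<kappa> "{..<d}" "\<lambda>_. UNIV" \<kappa>']) auto
qed (use M in auto)

lemma finite_multi_indices: "finite (multi_indices d k)"
proof (rule finite_subset)
  show "multi_indices d k \<subseteq> {f. \<forall>i. (i \<in> {..<d} \<longrightarrow> f i \<in> {..k}) \<and> (i \<notin> {..<d} \<longrightarrow> f i = 0)}"
  proof
    fix \<alpha> assume \<alpha>: "\<alpha> \<in> multi_indices d k"
    have "\<alpha> i \<le> k" if "i < d" for i
    proof -
      have "\<alpha> i \<le> (\<Sum>i<d. \<alpha> i)" using that by (intro member_le_sum) auto
      then show ?thesis using \<alpha> by (simp add: multi_indices_def)
    qed
    then show "\<alpha> \<in> {f. \<forall>i. (i \<in> {..<d} \<longrightarrow> f i \<in> {..k}) \<and> (i \<notin> {..<d} \<longrightarrow> f i = 0)}"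
      using \<alpha> by (auto simp: multi_indices_def)
  qed
qed (intro finite_set_of_finite_funs; simp)

lemma C2_norm_bumps_le:
  assumes H: "H \<subseteq> PiE {..<d} (\<lambda>_. UNIV)" and k: "k \<ge> 1" and M: "M \<ge> 0"
    and c: "\<And>\<kappa> j. \<kappa> \<in> H \<Longrightarrow> j < m \<Longrightarrow> \<bar>c j \<kappa>\<bar> \<le> M"
  shows "C2_norm d m (\<lambda>x j. bumps d k H (c j) (\<lambda>_. 0) x) \<le> real m * (M * (900 * k\<^sup>2))"
proof -
  have "(SUP x\<in>unit_cube d. L2_set (\<lambda>j. multi_deriv d \<alpha> (\<lambda>y. bumps d k H (c j) (\<lambda>_. 0) y) x) {..<m})
      \<le> real m * (M * (900 * k\<^sup>2))" if \<alpha>: "\<alpha> \<in> multi_indices d 2" for \<alpha>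
  proof (rule cSUP_least[OF unit_cube_nonempty])
    fix x assume x: "x \<in> unit_cube d"
    have "L2_set (\<lambda>j. multi_deriv d \<alpha> (\<lambda>y. bumps d k H (c j) (\<lambda>_. 0) y) x) {..<m} =
        L2_set (\<lambda>j. bumps d k H (c j) \<alpha> x) {..<m}"
      using multi_deriv_bumps[OF \<alpha> x] by simp
    also have "\<dots> \<le> (\<Sum>j<m. \<bar>bumps d k H (c j) \<alpha> x\<bar>)" by (rule L2_set_le_sum_abs)
    also have "\<dots> \<le> (\<Sum>j<m. M * (900 * k\<^sup>2))"
      by (intro sum_mono abs_bumps_le[OF H k _ M \<alpha>] c) auto
    finally show "L2_set (\<lambda>j. multi_deriv d \<alpha> (\<lambda>y. bumps d k H (c j) (\<lambda>_. 0) y) x) {..<m} \<le> real m * (M * (900 * k\<^sup>2))"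
      by simp
  qed
  moreover have "(\<lambda>_. 0) \<in> multi_indices d 2" by (simp add: multi_indices_def)
  ultimately show ?thesis
    unfolding C2_norm_def by (subst Max_le_iff) (auto simp: finite_multi_indices)
qed

unbundle no vec_syntax

section \<open>Graphs through rational points\<close>

lemma bumps_at:
  assumes H: "H \<subseteq> PiE {..<d} (\<lambda>_. UNIV)" "finite H" "\<kappa> \<in> H"
    and nz: "\<And>i. i < d \<Longrightarrow> cutoff 0 (k * x i - real (\<kappa> i)) \<noteq> 0"
  shows "bumps d k H c (\<lambda>_. 0) x = c \<kappa> * (\<Prod>i<d. cutoff 0 (k * x i - real (\<kappa> i)))"
proof -
  have "(\<Prod>i<d. cutoff 0 (k * x i - real (\<kappa>' i))) = 0" if \<kappa>': "\<kappa>' \<in> H - {\<kappa>}" for \<kappa>'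
  proof (rule ccontr)
    assume "(\<Prod>i<d. cutoff 0 (k * x i - real (\<kappa>' i))) \<noteq> 0"
    then have "cutoff 0 (k * x i - real (\<kappa>' i)) \<noteq> 0" if "i < d" for i
      using that by (auto simp: prod_zero_iff)
    then have "\<kappa>' i = \<kappa> i" if "i < d" for i
      using nz that by (metis cutoff_cells_disjoint)
    then have "\<kappa>' = \<kappa>" using H \<kappa>' by (intro PiE_ext[of \<kappa>' "{..<d}" "\<lambda>_. UNIV" \<kappa>]) auto
    then show False using \<kappa>' by simp
  qed
  then have "(\<Sum>\<kappa>'\<in>H - {\<kappa>}. c \<kappa>' * (\<Prod>i<d. cutoff 0 (k * x i - real (\<kappa>' i)))) = 0"
    by (intro sum.neutral) simp
  then show ?thesis unfolding bumps_def by (subst sum.remove[OF H(2,3)]) simp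
qed

text \<open>The linear map \<open>(\<xi>, y) \<mapsto> (\<xi>, y - \<beta> \<xi>)\<close>.\<close>

definition shear_mat :: "nat \<Rightarrow> nat \<Rightarrow> (nat \<Rightarrow> nat \<Rightarrow> real) \<Rightarrow> real mat" where
  "shear_mat d m \<beta> = four_block_mat (1\<^sub>m d) (0\<^sub>m d m) (mat m d (\<lambda>(j, i). - \<beta> j i)) (1\<^sub>m m)"

lemma shear_mat_special_linear: "shear_mat d m \<beta> \<in> special_linear (d + m)"
proof -
  have "det (shear_mat d m \<beta>) = det (1\<^sub>m d :: real mat) * det (1\<^sub>m m)"
    unfolding shear_mat_def by (rule det_four_block_mat_upper_right_zero[where n = d and m = m]) auto
  then show ?thesis unfolding special_linear_def shear_mat_def by simp
qed

lemma shear_mat_entry: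
  assumes "i < d + m" "l < d + m"
  shows "shear_mat d m \<beta> $$ (i, l) - (if i = l then 1 else 0) = (if d \<le> i \<and> l < d then - \<beta> (i - d) l else 0)"
  using assms by (auto simp: shear_mat_def)

lemma shear_mat_mult:
  "shear_mat d m \<beta> *\<^sub>v (vec d \<xi> @\<^sub>v vec m y) = vec d \<xi> @\<^sub>v vec m (\<lambda>j. y j - (\<Sum>i<d. \<beta> j i * \<xi> i))"
proof -
  have "shear_mat d m \<beta> *\<^sub>v (vec d \<xi> @\<^sub>v vec m y) =
      (1\<^sub>m d *\<^sub>v vec d \<xi> + 0\<^sub>m d m *\<^sub>v vec m y) @\<^sub>v
      (mat m d (\<lambda>(j, i). - \<beta> j i) *\<^sub>v vec d \<xi> + 1\<^sub>m m *\<^sub>v vec m y)"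
    unfolding shear_mat_def by (rule four_block_mat_mult_vec) auto
  also have "1\<^sub>m d *\<^sub>v vec d \<xi> + 0\<^sub>m d m *\<^sub>v vec m y = vec d \<xi>"
    by (rule eq_vecI) (auto simp: scalar_prod_def)
  also have "mat m d (\<lambda>(j, i). - \<beta> j i) *\<^sub>v vec d \<xi> + 1\<^sub>m m *\<^sub>v vec m y = vec m (\<lambda>j. y j - (\<Sum>i<d. \<beta> j i * \<xi> i))"
    by (rule eq_vecI) (auto simp: scalar_prod_def sum_negf lessThan_atLeast0)
  finally show ?thesis .
qed

lemma append_vec_eq_left:
  assumes "vec d f @\<^sub>v v = vec d g @\<^sub>v w" "i < d"
  shows "f i = g i"
proof -
  have "(vec d f @\<^sub>v v) $ i = (vec d g @\<^sub>v w) $ i" using assms(1) by simp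
  then show ?thesis using assms(2) by (simp add: index_append_vec)
qed

text \<open>A point of the image of the graph is determined by its first \<open>d\<close> coordinates, which the shear does
  not change.\<close>

lemma finite_shear_graph_inter:
  assumes Q: "Q > 0"
  shows "finite ((\<lambda>v. shear_mat d m \<beta> *\<^sub>v v) ` graph_manifold d m \<phi> \<inter> scaled_primitive_vecs Q (d + m))"
proof (rule finite_subset)
  define X where "X = PiE {..<d} (\<lambda>_. (\<lambda>z::int. real_of_int z / Q) ` {0..\<lfloor>Q\<rfloor>})"
  show "finite ((\<lambda>\<xi>. shear_mat d m \<beta> *\<^sub>v (vec d \<xi> @\<^sub>v vec m (\<phi> \<xi>))) ` X)"
    unfolding X_def by (intro finite_imageI finite_PiE) auto
  show "(\<lambda>v. shear_mat d m \<beta> *\<^sub>v v) ` graph_manifold d m \<phi> \<inter> scaled_primitive_vecs Q (d + m)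
      \<subseteq> (\<lambda>\<xi>. shear_mat d m \<beta> *\<^sub>v (vec d \<xi> @\<^sub>v vec m (\<phi> \<xi>))) ` X"
  proof
    fix w assume w: "w \<in> (\<lambda>v. shear_mat d m \<beta> *\<^sub>v v) ` graph_manifold d m \<phi> \<inter> scaled_primitive_vecs Q (d + m)"
    then obtain \<xi> where \<xi>: "\<xi> \<in> unit_cube d" "w = shear_mat d m \<beta> *\<^sub>v (vec d \<xi> @\<^sub>v vec m (\<phi> \<xi>))"
      by (auto simp: graph_manifold_def)
    from w obtain v where v: "v \<in> carrier_vec (d + m)" "w = (1 / Q) \<cdot>\<^sub>v map_vec real_of_int v"
      by (auto simp: scaled_primitive_vecs_def primitive_vecs_def)
    have "\<xi> i \<in> (\<lambda>z::int. real_of_int z / Q) ` {0..\<lfloor>Q\<rfloor>}" if i: "i < d" for i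
    proof -
      have "w $ i = \<xi> i" using i unfolding \<xi>(2) shear_mat_mult by (simp add: index_append_vec)
      moreover have "w $ i = real_of_int (v $ i) / Q" using i v by simp
      ultimately have eq: "\<xi> i = real_of_int (v $ i) / Q" by simp
      have "0 \<le> \<xi> i" "\<xi> i \<le> 1" using unit_cube_coord[OF \<xi>(1) i] by auto
      then have "0 \<le> real_of_int (v $ i)" "real_of_int (v $ i) \<le> Q"
        unfolding eq using Q by (auto simp: field_simps)
      then show ?thesis unfolding eq by (intro imageI) (auto simp: le_floor_iff)
    qed
    then have "\<xi> \<in> X" using \<xi>(1) by (auto simp: X_def unit_cube_def PiE_iff)
    then show "w \<in> (\<lambda>\<xi>. shear_mat d m \<beta> *\<^sub>v (vec d \<xi> @\<^sub>v vec m (\<phi> \<xi>))) ` X" using \<xi>(2) by blast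
  qed
qed

lemma primitive_vecsI:
  assumes "v \<in> carrier_vec n" "i < n" "j < n" "coprime (v $ i) (v $ j)"
  shows "v \<in> primitive_vecs n"
proof -
  have mem: "v $ i \<in> set\<^sub>v v" "v $ j \<in> set\<^sub>v v" using assms(1-3) by (auto simp: vec_set_def)
  then have "Gcd (set\<^sub>v v) dvd v $ i" "Gcd (set\<^sub>v v) dvd v $ j" by auto
  then have "is_unit (Gcd (set\<^sub>v v))" using assms(4) by (meson coprime_common_divisor)
  then have "Gcd (set\<^sub>v v) = 1" by (metis is_unit_normalize normalize_Gcd)
  moreover have "v \<noteq> 0\<^sub>v n" using assms by auto
  ultimately show ?thesis using assms(1) by (simp add: primitive_vecs_def)
qed

context shear_counting
begin

lemma slot_disjoint:
  assumes "a \<in> slot k" "a \<in> slot l"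
  shows "k = l"
proof -
  have w: "width > 0" using width_bounds by simp
  have "width * (k + 1 / 4) \<le> width * (l + 3 / 4)" "width * (l + 1 / 4) \<le> width * (k + 3 / 4)"
    using assms unfolding slot_def by auto
  then have "real k + 1 / 4 \<le> real l + 3 / 4" "real l + 1 / 4 \<le> real k + 3 / 4"
    using w by simp_all
  then show ?thesis by linarith
qed

lemma slot_scaled:
  assumes "a \<in> slot k"
  shows "1 / 4 \<le> real K * (real_of_int a / Q) - real k" "real K * (real_of_int a / Q) - real k \<le> 3 / 4"
proof -
  have w: "width > 0" using width_bounds by simp
  have eq: "real K * (real_of_int a / Q) = real_of_int a / width" by (simp add: width_def)
  have "real k + 1 / 4 \<le> real_of_int a / width" "real_of_int a / width \<le> real k + 3 / 4"
    using assms w by (auto simp: slot_def field_simps)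
  then show "1 / 4 \<le> real K * (real_of_int a / Q) - real k" "real K * (real_of_int a / Q) - real k \<le> 3 / 4"
    unfolding eq by linarith+
qed

text \<open>In each cell with a hit \<open>\<alpha>\<close>, a bump on that cell moves the point of the graph over \<open>\<alpha> / Q\<close> to the
  nearby point that the shear takes to \<open>Q\<^sup>-\<^sup>1 \<int>\<^sup>n\<close>.\<close>

lemma graph_through_hits:
  assumes m: "m \<ge> 1" and \<phi>: "\<phi> \<in> C2_maps d m" and B: "B \<in> Shears m"
    and \<Theta>: "\<Theta> = (\<lambda>\<alpha> j. Q * \<phi> (restrict (\<lambda>i. real_of_int (\<alpha> i) / Q) {..<d}) j)"
    and H: "H = {\<kappa>\<in>Cells. \<exists>\<alpha>\<in>Cell \<kappa>. hits m \<Theta> \<alpha> B}"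
  shows "\<exists>g\<in>special_linear (d + m). \<exists>\<psi>\<in>C2_maps d m.
     (MAX (i, j)\<in>{..<d + m} \<times> {..<d + m}. \<bar>g $$ (i, j) - (if i = j then 1 else 0)\<bar>) < 2 * \<delta> \<and>
     C2_norm d m (\<lambda>x j. \<phi> x j - \<psi> x j) \<le> real m * (\<eta> / Q * 4096 ^ d * (900 * (real K)\<^sup>2)) \<and>
     card H \<le> card ((\<lambda>v. g *\<^sub>v v) ` graph_manifold d m \<psi> \<inter> scaled_primitive_vecs Q (d + m))"
proof -
  have Q0: "Q > 0" and P0: "real P > 0" using Q P by auto
  define pt :: "(nat \<Rightarrow> int) \<Rightarrow> nat \<Rightarrow> real" where "pt \<alpha> = restrict (\<lambda>i. real_of_int (\<alpha> i) / Q) {..<d}" for \<alpha>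
  define \<beta> where "\<beta> j i = \<delta> / P * real_of_int (B j i)" for j i
  define g where "g = shear_mat d m \<beta>"
  have finH: "finite H" unfolding H by simp
  have subH: "H \<subseteq> PiE {..<d} (\<lambda>_. UNIV)" unfolding H Cells_def by (auto simp: PiE_iff extensional_def)
  have "\<forall>\<kappa>\<in>H. \<exists>\<alpha>. \<alpha> \<in> Cell \<kappa> \<and> hits m \<Theta> \<alpha> B" unfolding H by blast
  then obtain a where a: "\<And>\<kappa>. \<kappa> \<in> H \<Longrightarrow> a \<kappa> \<in> Cell \<kappa>" "\<And>\<kappa>. \<kappa> \<in> H \<Longrightarrow> hits m \<Theta> (a \<kappa>) B" by metis
  have "\<forall>\<kappa>\<in>H. \<exists>z. \<forall>j<m. z j \<in> (if j = 0 then {z. coprime z (a \<kappa> 0)} else UNIV) \<and>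
      \<bar>\<Theta> (a \<kappa>) j - \<delta> / P * lin d (a \<kappa>) (B j) - real_of_int (z j)\<bar> \<le> \<eta>"
    using a(2) unfolding hits_def near_def by (intro ballI choice_iff'[THEN iffD1]) blast
  then obtain z where z: "\<And>\<kappa> j. \<kappa> \<in> H \<Longrightarrow> j < m \<Longrightarrow> z \<kappa> j \<in> (if j = 0 then {z. coprime z (a \<kappa> 0)} else UNIV) \<and>
      \<bar>\<Theta> (a \<kappa>) j - \<delta> / P * lin d (a \<kappa>) (B j) - real_of_int (z \<kappa> j)\<bar> \<le> \<eta>" by metis
  have sl: "a \<kappa> i \<in> slot (\<kappa> i)" if "\<kappa> \<in> H" "i < d" for \<kappa> i
    using a(1)[OF that(1)] that(2) by (auto simp: Cell_def PiE_iff)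
  have ptd: "pt \<alpha> i = real_of_int (\<alpha> i) / Q" if "i < d" for \<alpha> i using that by (simp add: pt_def)
  have cut: "1 / 4096 \<le> cutoff 0 (real K * pt (a \<kappa>) i - real (\<kappa> i))" if "\<kappa> \<in> H" "i < d" for \<kappa> i
    unfolding ptd[OF that(2)] using slot_scaled[OF sl[OF that]] by (intro cutoff_0_ge)
  have cube: "pt (a \<kappa>) \<in> unit_cube d" if \<kappa>: "\<kappa> \<in> H" for \<kappa>
  proof -
    have "0 \<le> pt (a \<kappa>) i \<and> pt (a \<kappa>) i \<le> 1" if i: "i < d" for i
    proof -
      have "\<kappa> i < K" using \<kappa> i unfolding H Cells_def by (auto simp: PiE_iff)
      then have "real (\<kappa> i) + 1 \<le> real K" by linarith
      then have "0 \<le> real K * pt (a \<kappa>) i" "real K * pt (a \<kappa>) i \<le> real K * 1"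
        using slot_scaled[OF sl[OF \<kappa> i]] unfolding ptd[OF i] by linarith+
      then show ?thesis using K by (simp add: zero_le_mult_iff)
    qed
    then show ?thesis by (auto simp: unit_cube_def PiE_iff pt_def)
  qed
  define y where "y \<kappa> j = (real_of_int (z \<kappa> j) + \<delta> / P * lin d (a \<kappa>) (B j)) / Q" for \<kappa> j
  define h where "h \<kappa> = (\<Prod>i<d. cutoff 0 (real K * pt (a \<kappa>) i - real (\<kappa> i)))" for \<kappa>
  define c where "c j \<kappa> = (y \<kappa> j - \<phi> (pt (a \<kappa>)) j) / h \<kappa>" for j \<kappa>
  define \<psi> where "\<psi> x j = \<phi> x j + bumps d K H (c j) (\<lambda>_. 0) x" for x j
  have h: "(1 / 4096) ^ d \<le> h \<kappa>" if "\<kappa> \<in> H" for \<kappa>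
  proof -
    have "(\<Prod>i<d. 1 / 4096) \<le> h \<kappa>" unfolding h_def using cut[OF that] by (intro prod_mono) auto
    then show ?thesis by simp
  qed
  have h0: "h \<kappa> > 0" if "\<kappa> \<in> H" for \<kappa> using h[OF that] by (rule less_le_trans[rotated]) simp
  have yd: "\<bar>y \<kappa> j - \<phi> (pt (a \<kappa>)) j\<bar> \<le> \<eta> / Q" if "\<kappa> \<in> H" "j < m" for \<kappa> j
  proof -
    have "y \<kappa> j - \<phi> (pt (a \<kappa>)) j = - (\<Theta> (a \<kappa>) j - \<delta> / P * lin d (a \<kappa>) (B j) - real_of_int (z \<kappa> j)) / Q"
      using Q0 unfolding y_def \<Theta> pt_def by (simp add: field_simps)
    moreover have "\<bar>\<Theta> (a \<kappa>) j - \<delta> / P * lin d (a \<kappa>) (B j) - real_of_int (z \<kappa> j)\<bar> \<le> \<eta>"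
      using z[OF that] by blast
    ultimately show ?thesis using Q0 by (simp add: divide_right_mono)
  qed
  have c_le: "\<bar>c j \<kappa>\<bar> \<le> \<eta> / Q * 4096 ^ d" if "\<kappa> \<in> H" "j < m" for \<kappa> j
  proof -
    have "\<bar>c j \<kappa>\<bar> = \<bar>y \<kappa> j - \<phi> (pt (a \<kappa>)) j\<bar> / h \<kappa>" using h0[OF that(1)] by (simp add: c_def)
    also have "\<dots> \<le> (\<eta> / Q) / (1 / 4096) ^ d"
      using yd[OF that] h[OF that(1)] by (intro frac_le) auto
    finally show ?thesis by (simp add: power_divide)
  qed
  have \<psi>_pt: "\<psi> (pt (a \<kappa>)) j = y \<kappa> j" if \<kappa>: "\<kappa> \<in> H" for \<kappa> j
  proof -
    have "cutoff 0 (real K * pt (a \<kappa>) i - real (\<kappa> i)) \<noteq> 0" if "i < d" for i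
      using cut[OF \<kappa> that] by linarith
    then have "bumps d K H (c j) (\<lambda>_. 0) (pt (a \<kappa>)) = c j \<kappa> * h \<kappa>"
      unfolding h_def by (rule bumps_at[OF subH finH \<kappa>])
    then show ?thesis using h0[OF \<kappa>] by (simp add: \<psi>_def c_def)
  qed
  have \<psi>: "\<psi> \<in> C2_maps d m"
    using \<phi> unfolding C2_maps_def \<psi>_def by (auto intro!: Ck_cube_add Ck_cube_bumps)
  have "(\<lambda>x j. \<phi> x j - \<psi> x j) = (\<lambda>x j. bumps d K H ((\<lambda>j \<kappa>. - c j \<kappa>) j) (\<lambda>_. 0) x)"
    unfolding \<psi>_def bumps_def by (auto simp: sum_negf fun_eq_iff)
  moreover have "C2_norm d m (\<lambda>x j. bumps d K H ((\<lambda>j \<kappa>. - c j \<kappa>) j) (\<lambda>_. 0) x) \<le>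
      real m * (\<eta> / Q * 4096 ^ d * (900 * (real K)\<^sup>2))"
    using K eta Q0 c_le by (intro C2_norm_bumps_le[OF subH]) auto
  ultimately have norm: "C2_norm d m (\<lambda>x j. \<phi> x j - \<psi> x j) \<le> real m * (\<eta> / Q * 4096 ^ d * (900 * (real K)\<^sup>2))"
    by simp
  have entries: "(MAX (i, j)\<in>{..<d + m} \<times> {..<d + m}. \<bar>g $$ (i, j) - (if i = j then 1 else 0)\<bar>) < 2 * \<delta>"
  proof -
    have "\<bar>g $$ (i, l) - (if i = l then 1 else 0)\<bar> < 2 * \<delta>" if il: "i < d + m" "l < d + m" for i l
    proof (cases "d \<le> i \<and> l < d")
      case True
      have "B (i - d) \<in> Row" using B True il by (auto simp: Shears_def PiE_iff)
      then have b: "0 \<le> B (i - d) l" "B (i - d) l < int P" using True by (auto simp: Row_def PiE_iff)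
      then have "real_of_int (B (i - d) l) / P \<le> 1" using P0 by simp
      then have "\<delta> * (real_of_int (B (i - d) l) / P) \<le> \<delta> * 1" using delta by (intro mult_left_mono) auto
      moreover have "0 \<le> \<delta> * (real_of_int (B (i - d) l) / P)" using b delta by simp
      ultimately show ?thesis using True delta unfolding g_def shear_mat_entry[OF il] \<beta>_def by simp
    next
      case False
      show ?thesis unfolding g_def shear_mat_entry[OF il] using False delta by auto
    qed
    then show ?thesis using d by (subst Max_less_iff) (auto simp: lessThan_empty_iff)
  qed
  define p where "p \<kappa> = vec d (pt (a \<kappa>)) @\<^sub>v vec m (\<lambda>j. real_of_int (z \<kappa> j) / Q)" for \<kappa>
  have "card H \<le> card ((\<lambda>v. g *\<^sub>v v) ` graph_manifold d m \<psi> \<inter> scaled_primitive_vecs Q (d + m))"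
  proof (rule card_inj_on_le[of p])
    show "finite ((\<lambda>v. g *\<^sub>v v) ` graph_manifold d m \<psi> \<inter> scaled_primitive_vecs Q (d + m))"
      unfolding g_def by (rule finite_shear_graph_inter[OF Q0])
    show "inj_on p H"
    proof (rule inj_onI)
      fix \<kappa> \<kappa>' assume \<kappa>: "\<kappa> \<in> H" "\<kappa>' \<in> H" and eq: "p \<kappa> = p \<kappa>'"
      have "\<kappa> i = \<kappa>' i" if i: "i < d" for i
      proof -
        have "pt (a \<kappa>) i = pt (a \<kappa>') i" using eq i unfolding p_def by (rule append_vec_eq_left)
        then have "a \<kappa> i = a \<kappa>' i" using Q0 by (simp add: ptd[OF i])
        then show ?thesis using slot_disjoint sl[OF \<kappa>(1) i] sl[OF \<kappa>(2) i] by metis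
      qed
      then show "\<kappa> = \<kappa>'" using subH \<kappa> by (intro PiE_ext[of \<kappa> "{..<d}" "\<lambda>_. UNIV" \<kappa>']) auto
    qed
    show "p ` H \<subseteq> (\<lambda>v. g *\<^sub>v v) ` graph_manifold d m \<psi> \<inter> scaled_primitive_vecs Q (d + m)"
    proof (rule image_subsetI, rule IntI)
      fix \<kappa> assume \<kappa>: "\<kappa> \<in> H"
      have "g *\<^sub>v (vec d (pt (a \<kappa>)) @\<^sub>v vec m (\<psi> (pt (a \<kappa>)))) = p \<kappa>"
        unfolding g_def shear_mat_mult p_def
      proof (intro arg_cong2[where f = append_vec] refl eq_vecI)
        fix j assume "j < dim_vec (vec m (\<lambda>j. real_of_int (z \<kappa> j) / Q))"
        then have j: "j < m" by simp
        have "(\<Sum>i<d. \<beta> j i * pt (a \<kappa>) i) = (\<Sum>i<d. \<delta> / P / Q * (a \<kappa> i * B j i))"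
          by (intro sum.cong) (auto simp: \<beta>_def ptd)
        also have "\<dots> = \<delta> / P * lin d (a \<kappa>) (B j) / Q"
          unfolding lin_def sum_distrib_left[symmetric] by simp
        finally have "(\<Sum>i<d. \<beta> j i * pt (a \<kappa>) i) = \<delta> / P * lin d (a \<kappa>) (B j) / Q" .
        then show "vec m (\<lambda>j. \<psi> (pt (a \<kappa>)) j - (\<Sum>i<d. \<beta> j i * pt (a \<kappa>) i)) $ j =
            vec m (\<lambda>j. real_of_int (z \<kappa> j) / Q) $ j"
          using j by (simp add: \<psi>_pt[OF \<kappa>] y_def add_divide_distrib)
      qed simp
      then show "p \<kappa> \<in> (\<lambda>v. g *\<^sub>v v) ` graph_manifold d m \<psi>"
        unfolding graph_manifold_def using cube[OF \<kappa>] by (metis (no_types, lifting) image_eqI)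
      define v where "v = vec d (a \<kappa>) @\<^sub>v vec m (z \<kappa>)"
      have "v \<in> primitive_vecs (d + m)"
      proof (rule primitive_vecsI)
        show "v \<in> carrier_vec (d + m)" by (simp add: v_def)
        show "d < d + m" "0 < d + m" using m by auto
        have "coprime (z \<kappa> 0) (a \<kappa> 0)" using z[OF \<kappa>, of 0] m by simp
        then show "coprime (v $ d) (v $ 0)" using d m by (simp add: v_def index_append_vec)
      qed
      moreover have "p \<kappa> = (1 / Q) \<cdot>\<^sub>v map_vec real_of_int v"
        unfolding p_def v_def by (rule eq_vecI) (auto simp: index_append_vec ptd)
      ultimately show "p \<kappa> \<in> scaled_primitive_vecs Q (d + m)"
        unfolding scaled_primitive_vecs_def by blast
    qed
  qed
  then show ?thesis
    using \<psi> norm entries shear_mat_special_linear[of d m \<beta>] unfolding g_def by blast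
qed

end

section \<open>Choice of the parameters\<close>

lemma eventually_large:
  fixes s u \<delta> \<epsilon> :: real
  assumes "s > 0" "u > 0" "\<delta> > 0" "\<epsilon> > 0"
  shows "\<forall>\<^sub>F Q in at_top. 2 \<le> Q \<and> \<epsilon> * Q powr (- u) \<le> 1 / 4 \<and> 2 \<le> \<epsilon> * Q powr s \<and>
     1536 + 384 * ln Q \<le> \<delta> * (Q powr s / 2)"
proof -
  define c where "c = 2 * (1536 + 768 / s) / \<delta>"
  have ev: "\<forall>\<^sub>F Q in at_top. c' \<le> Q powr a" if a: "a > 0" for a c' :: real
    using eventually_ge_at_top[of "max 1 c' powr (1 / a)"]
  proof eventually_elim
    case (elim Q)
    have "max 1 c' = (max 1 c' powr (1 / a)) powr a" using a by (simp add: powr_powr)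
    also have "\<dots> \<le> Q powr a" using elim a by (intro powr_mono2) auto
    finally show ?case by simp
  qed
  have "s / 2 > 0" using assms by simp
  from ev[OF \<open>u > 0\<close>, of "4 * \<epsilon>"] ev[OF \<open>s > 0\<close>, of "2 / \<epsilon>"] ev[OF this, of "max 1 c"]
    eventually_ge_at_top[of "2 :: real"]
  show ?thesis
  proof eventually_elim
    case (elim Q)
    define y where "y = Q powr (s / 2)"
    have y: "1 \<le> y" "c \<le> y" using elim by (auto simp: y_def)
    have "ln Q \<le> y / (s / 2)" unfolding y_def using elim assms by (intro ln_powr_bound) auto
    then have "1536 + 384 * ln Q \<le> 1536 * y + 768 / s * y" using y by simp
    also have "\<dots> = \<delta> * (c * y / 2)" using assms by (simp add: c_def field_simps)
    also have "\<dots> \<le> \<delta> * (y * y / 2)"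
      using y assms by (intro mult_left_mono divide_right_mono mult_right_mono) auto
    also have "y * y = Q powr s" by (simp add: y_def flip: powr_add)
    finally have "1536 + 384 * ln Q \<le> \<delta> * (Q powr s / 2)" .
    moreover have "\<epsilon> * Q powr (- u) \<le> 1 / 4" using elim by (simp add: powr_minus field_simps)
    moreover have "2 \<le> \<epsilon> * Q powr s" using elim assms by (simp add: field_simps)
    ultimately show ?case using elim by simp
  qed
qed

text \<open>The theorem for fixed \<open>d\<close>, with the conditions on the parameters made explicit and without the factor
  \<open>\<delta> ^ (n\<^sup>2 - 1)\<close>.\<close>

lemma many_points:
  fixes n d :: nat and \<delta> \<epsilon> Q :: real
  defines "p \<equiv> real n / real (d + 2 * (n - d))"
  assumes d: "1 \<le> d" "d \<le> n - 1" and \<delta>: "0 < \<delta>" "\<delta> < 1"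
    and \<epsilon>: "0 < \<epsilon>" "\<epsilon> < 1" "2 * \<epsilon> * (256 / \<delta>) ^ n \<le> (1 / 128) ^ n"
    and Q_large: "2 \<le> Q" "\<epsilon> * Q powr (1 - 2 * p) \<le> 1 / 4" "2 \<le> \<epsilon> * Q powr (1 - p)"
      "1536 + 384 * ln Q \<le> \<delta> * (Q powr (1 - p) / 2)"
    and \<phi>: "\<phi> \<in> C2_maps d (n - d)"
  shows "\<exists>g\<in>special_linear n. \<exists>\<psi>\<in>C2_maps d (n - d).
     (MAX (i, j)\<in>{..<n} \<times> {..<n}. \<bar>g $$ (i, j) - (if i = j then 1 else 0)\<bar>) < 2 * \<delta> \<and>
     C2_norm d (n - d) (\<lambda>x j. \<phi> x j - \<psi> x j) \<le> (real n * 4096 ^ n * 900) * \<epsilon> \<and>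
     1 / 8 * (1 / 512) ^ n * \<epsilon> ^ (n - d) * Q powr (real (d * n) / real (d + 2 * (n - d))) \<le>
       real (card ((\<lambda>v. g *\<^sub>v v) ` graph_manifold d (n - d) \<psi> \<inter> scaled_primitive_vecs Q n))"
proof -
  define m where "m = n - d"
  have m: "m \<ge> 1" and n: "n = d + m" using d by (auto simp: m_def)
  have p: "p = real n / real (d + 2 * m)" by (simp add: p_def m_def)
  have p01: "0 < p" "p < 1" using d m unfolding p n by auto
  define K where "K = nat \<lceil>Q powr p\<rceil>"
  have Qp1: "1 < Q powr p" using Q_large(1) p01 by (intro gr_one_powr) auto
  have K_bds: "Q powr p \<le> real K" "real K \<le> 2 * Q powr p" "K \<ge> 2"
    using Qp1 unfolding K_def by linarith+
  have K0: "real K > 0" using K_bds by simp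
  have Q0: "Q > 0" using Q_large by simp
  define \<eta> where "\<eta> = \<epsilon> * Q / (real K)\<^sup>2"
  have \<eta>0: "\<eta> > 0" using \<epsilon> Q0 K0 by (simp add: \<eta>_def)
  define P where "P = nat \<lceil>Q / \<eta>\<rceil> + 2"
  have wide: "Q powr (1 - p) / 2 \<le> Q / real K"
  proof -
    have "Q powr (1 - p) / 2 = Q / (2 * Q powr p)" using Q0 by (simp add: powr_diff)
    also have "\<dots> \<le> Q / real K" using K_bds K0 Q0 by (intro divide_left_mono) auto
    finally show ?thesis .
  qed
  interpret shear_counting d P K \<delta> \<eta> Q
  proof
    show "\<eta> \<le> 1 / 4"
    proof -
      have "(Q powr p)\<^sup>2 \<le> (real K)\<^sup>2" using K_bds by (intro power_mono) auto
      then have "\<eta> \<le> \<epsilon> * Q / (Q powr p)\<^sup>2"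
        unfolding \<eta>_def using \<epsilon> Q0 K0 Qp1 by (intro divide_left_mono) auto
      also have "(Q powr p)\<^sup>2 = Q powr (2 * p)" using Q0 by (simp add: power2_eq_square flip: powr_add)
      also have "\<epsilon> * Q / Q powr (2 * p) = \<epsilon> * Q powr (1 - 2 * p)" using Q0 by (simp add: powr_diff)
      finally show ?thesis using Q_large by simp
    qed
    show "1 \<le> \<eta> * real K"
    proof -
      have "1 \<le> \<epsilon> * (Q powr (1 - p) / 2)" using Q_large by simp
      also have "\<dots> \<le> \<epsilon> * (Q / real K)" using wide \<epsilon> by (intro mult_left_mono) auto
      also have "\<dots> = \<eta> * real K" using K0 by (simp add: \<eta>_def power2_eq_square)
      finally show ?thesis .
    qed
    show "1536 + 384 * ln Q \<le> \<delta> * (Q / real K)"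
    proof -
      have "\<delta> * (Q powr (1 - p) / 2) \<le> \<delta> * (Q / real K)" using wide \<delta> by (intro mult_left_mono) auto
      then show ?thesis using Q_large by linarith
    qed
    show "Q \<le> \<eta> * real P"
    proof -
      have "Q / \<eta> \<le> real P" unfolding P_def by linarith
      then show ?thesis using \<eta>0 by (simp add: field_simps)
    qed
  qed (use d \<delta> Q_large K_bds \<eta>0 in \<open>auto simp: P_def\<close>)
  define \<Theta> where "\<Theta> = (\<lambda>\<alpha> j. Q * \<phi> (restrict (\<lambda>i. real_of_int (\<alpha> i) / Q) {..<d}) j)"
  \<comment> \<open>up to constants, the expected number of hits in a cell; it is comparable with \<open>\<epsilon> ^ m\<close>\<close>
  define \<mu> where "\<mu> = width ^ d * \<eta> ^ m"
  define c where "c = (width / 4) ^ d * (\<eta> / 128) ^ m - (width ^ d * \<eta> ^ m)\<^sup>2 * (256 / \<delta>) ^ m"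
  obtain B where B: "B \<in> Shears m"
    "real (card Cells) * c \<le> real (card {\<kappa>\<in>Cells. \<exists>\<alpha>\<in>Cell \<kappa>. hits m \<Theta> \<alpha> B})"
    by (rule exists_good_shear[OF m c_def])
  have \<mu>_eq: "\<mu> = \<epsilon> ^ m * (Q ^ n / real K ^ (d + 2 * m))"
    unfolding \<mu>_def \<eta>_def width_def n
    by (simp add: power_divide power_mult_distrib power_add power_mult)
  have Kpow: "(Q powr p) ^ (d + 2 * m) = Q ^ n"
  proof -
    have "(Q powr p) ^ (d + 2 * m) = Q powr (real (d + 2 * m) * p)"
      using Q0 by (subst powr_power) (auto simp: mult.commute)
    also have "real (d + 2 * m) * p = real n" using m unfolding p by simp
    finally show ?thesis using Q0 by (simp add: powr_realpow)
  qed
  have \<mu>_le: "\<mu> \<le> \<epsilon>"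
  proof -
    have "Q ^ n \<le> real K ^ (d + 2 * m)" unfolding Kpow[symmetric] by (rule power_mono[OF K_bds(1)]) simp
    then have "Q ^ n / real K ^ (d + 2 * m) \<le> 1" using K0 by simp
    then have "\<mu> \<le> \<epsilon> ^ m * 1" unfolding \<mu>_eq using \<epsilon> by (intro mult_left_mono) auto
    also have "\<dots> \<le> \<epsilon>" using \<epsilon> m power_decreasing[of 1 m \<epsilon>] by simp
    finally show ?thesis .
  qed
  have \<mu>_ge: "\<epsilon> ^ m * (1 / 4) ^ n \<le> \<mu>"
  proof -
    have "real K ^ (d + 2 * m) \<le> (2 * Q powr p) ^ (d + 2 * m)" using K_bds by (intro power_mono) simp_all
    also have "\<dots> = 2 ^ (d + 2 * m) * Q ^ n" by (simp only: power_mult_distrib Kpow)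
    also have "\<dots> \<le> 4 ^ n * Q ^ n"
    proof (rule mult_right_mono)
      have "(2::real) ^ (d + 2 * m) \<le> 2 ^ (2 * n)" unfolding n by (intro power_increasing) auto
      then show "(2::real) ^ (d + 2 * m) \<le> 4 ^ n" by (simp add: power_mult)
    qed (use Q0 in simp)
    finally have "(1 / 4) ^ n \<le> Q ^ n / real K ^ (d + 2 * m)"
      using K0 by (simp add: power_divide field_simps)
    then show ?thesis unfolding \<mu>_eq using \<epsilon> by (intro mult_left_mono) auto
  qed
  have \<mu>0: "\<mu> \<ge> 0" using \<mu>_ge by (rule order_trans[rotated]) (use \<epsilon> in simp)
  \<comment> \<open>pairs of hits cost at most half of the first moment, by the smallness of \<open>\<epsilon>\<close> in terms of \<open>\<delta>\<close>\<close>
  have c_ge: "(1 / 128) ^ n * \<mu> / 2 \<le> c"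
  proof -
    have "(1 / 128) ^ n \<le> (1 / 4 :: real) ^ d * (1 / 128) ^ m"
      unfolding n power_add by (intro mult_right_mono power_mono) auto
    then have "(1 / 128) ^ n * \<mu> \<le> (1 / 4) ^ d * (1 / 128) ^ m * \<mu>"
      using \<mu>0 by (intro mult_right_mono) auto
    also have "\<dots> = (width / 4) ^ d * (\<eta> / 128) ^ m" by (simp add: \<mu>_def power_divide)
    finally have 1: "(1 / 128) ^ n * \<mu> \<le> (width / 4) ^ d * (\<eta> / 128) ^ m" .
    have "(256 / \<delta>) ^ m \<le> (256 / \<delta>) ^ n" using \<delta> unfolding n by (intro power_increasing) auto
    then have "2 * (\<mu> * (256 / \<delta>) ^ m) \<le> 2 * (\<epsilon> * (256 / \<delta>) ^ n)"
      using \<mu>_le \<mu>0 \<delta> \<epsilon> by (intro mult_left_mono mult_mono) auto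
    also have "\<dots> \<le> (1 / 128) ^ n" using \<epsilon> by (simp add: mult.assoc)
    finally have "\<mu> * (2 * (\<mu> * (256 / \<delta>) ^ m)) \<le> \<mu> * (1 / 128) ^ n"
      using \<mu>0 by (intro mult_left_mono)
    then have 2: "\<mu>\<^sup>2 * (256 / \<delta>) ^ m \<le> (1 / 128) ^ n * \<mu> / 2"
      by (simp add: power2_eq_square mult_ac)
    show ?thesis using 1 2 unfolding c_def \<mu>_def by linarith
  qed
  have main: "1 / 8 * (1 / 512) ^ n * \<epsilon> ^ m * Q powr (real (d * n) / real (d + 2 * m)) \<le> real (card Cells) * c"
  proof -
    have "Q powr (real (d * n) / real (d + 2 * m)) = (Q powr p) ^ d"
      using Q0 unfolding p by (subst powr_power) (auto simp: mult.commute)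
    also have "\<dots> \<le> real K ^ d" by (rule power_mono[OF K_bds(1)]) simp
    finally have 1: "Q powr (real (d * n) / real (d + 2 * m)) / 4 \<le> real (card Cells)"
      using card_Cells by linarith
    have "(1 / 128) ^ n * (\<epsilon> ^ m * (1 / 4) ^ n) / 2 \<le> (1 / 128) ^ n * \<mu> / 2"
      using \<mu>_ge by (intro divide_right_mono mult_left_mono) auto
    also have "\<dots> \<le> c" by (rule c_ge)
    finally have 2: "(1 / 128) ^ n * (\<epsilon> ^ m * (1 / 4) ^ n) / 2 \<le> c" .
    have "(1 / 128 :: real) ^ n * (1 / 4) ^ n = (1 / 512) ^ n" unfolding power_mult_distrib[symmetric] by simp
    then have "1 / 8 * (1 / 512) ^ n * \<epsilon> ^ m * Q powr (real (d * n) / real (d + 2 * m)) =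
      (Q powr (real (d * n) / real (d + 2 * m)) / 4) * ((1 / 128) ^ n * (\<epsilon> ^ m * (1 / 4) ^ n) / 2)"
      by (simp add: mult_ac)
    also have "\<dots> \<le> real (card Cells) * c" using 1 2 \<epsilon> by (intro mult_mono) auto
    finally show ?thesis .
  qed
  obtain g \<psi> where g: "g \<in> special_linear (d + m)" "\<psi> \<in> C2_maps d m"
     "(MAX (i, j)\<in>{..<d + m} \<times> {..<d + m}. \<bar>g $$ (i, j) - (if i = j then 1 else 0)\<bar>) < 2 * \<delta>"
     "C2_norm d m (\<lambda>x j. \<phi> x j - \<psi> x j) \<le> real m * (\<eta> / Q * 4096 ^ d * (900 * (real K)\<^sup>2))"
     "card {\<kappa>\<in>Cells. \<exists>\<alpha>\<in>Cell \<kappa>. hits m \<Theta> \<alpha> B} \<le>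
        card ((\<lambda>v. g *\<^sub>v v) ` graph_manifold d m \<psi> \<inter> scaled_primitive_vecs Q (d + m))"
    using graph_through_hits[OF m _ B(1) \<Theta>_def refl] \<phi> unfolding m_def[symmetric] by blast
  have "real m * (\<eta> / Q * 4096 ^ d * (900 * (real K)\<^sup>2)) = (real m * 4096 ^ d * 900) * \<epsilon>"
    using Q0 K0 by (simp add: \<eta>_def field_simps)
  also have "\<dots> \<le> (real n * 4096 ^ n * 900) * \<epsilon>"
    using \<epsilon> unfolding n by (intro mult_right_mono mult_mono power_increasing) auto
  finally have norm: "C2_norm d m (\<lambda>x j. \<phi> x j - \<psi> x j) \<le> (real n * 4096 ^ n * 900) * \<epsilon>"
    using g(4) by linarith
  have "1 / 8 * (1 / 512) ^ n * \<epsilon> ^ m * Q powr (real (d * n) / real (d + 2 * m)) \<le>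
      real (card ((\<lambda>v. g *\<^sub>v v) ` graph_manifold d m \<psi> \<inter> scaled_primitive_vecs Q (d + m)))"
    using main B(2) g(5) by linarith
  then show ?thesis using g(1,2,3) norm unfolding m_def[symmetric] n[symmetric] by blast
qed

theorem theorem1p5:
  fixes n :: nat
  assumes "n \<ge> 3"
  shows "\<exists>C c \<delta>0 :: real. C > 0 \<and> c > 0 \<and> \<delta>0 > 0 \<and>
    (\<forall>\<delta>::real. 0 < \<delta> \<and> \<delta> < \<delta>0 \<longrightarrow>
      (\<exists>\<epsilon>0::real. \<epsilon>0 > 0 \<and>
        (\<forall>\<epsilon>::real. 0 < \<epsilon> \<and> \<epsilon> < \<epsilon>0 \<longrightarrow>
          (\<exists>Q0::real. Q0 > 0 \<and>
            (\<forall>d::nat. 1 \<le> d \<and> d \<le> n - 1 \<longrightarrow>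
              (\<forall>\<phi> \<in> C2_maps d (n - d). \<forall>Q::real. Q \<ge> Q0 \<longrightarrow>
                (\<exists>g \<in> special_linear n. \<exists>\<phi>g \<in> C2_maps d (n - d).
                  (MAX (i, j)\<in>{..<n} \<times> {..<n}. \<bar>g $$ (i, j) - (if i = j then 1 else 0)\<bar>) < 2 * \<delta> \<and>
                  C2_norm d (n - d) (\<lambda>x j. \<phi> x j - \<phi>g x j) \<le> C * \<epsilon> \<and>
                  real (card ((\<lambda>v. g *\<^sub>v v) ` graph_manifold d (n - d) \<phi>g
                              \<inter> scaled_primitive_vecs Q n))
                    \<ge> c * \<delta> ^ (n\<^sup>2 - 1) * \<epsilon> ^ (n - d)
                        * Q powr (real (d * n) / real (d + 2 * (n - d))))))))))"
proof (rule exI[of _ "real n * 4096 ^ n * 900"], rule exI[of _ "1 / 8 * (1 / 512) ^ n"], rule exI[of _ 1],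
    intro conjI allI impI)
  fix \<delta> :: real assume \<delta>: "0 < \<delta> \<and> \<delta> < 1"
  \<comment> \<open>the second term makes the pairs of hits negligible\<close>
  define e where "e = min 1 ((1 / 128) ^ n / (2 * (256 / \<delta>) ^ n))"
  show "\<exists>\<epsilon>0::real. \<epsilon>0 > 0 \<and>
        (\<forall>\<epsilon>::real. 0 < \<epsilon> \<and> \<epsilon> < \<epsilon>0 \<longrightarrow>
          (\<exists>Q0::real. Q0 > 0 \<and>
            (\<forall>d::nat. 1 \<le> d \<and> d \<le> n - 1 \<longrightarrow>
              (\<forall>\<phi> \<in> C2_maps d (n - d). \<forall>Q::real. Q \<ge> Q0 \<longrightarrow>
                (\<exists>g \<in> special_linear n. \<exists>\<phi>g \<in> C2_maps d (n - d).
                  (MAX (i, j)\<in>{..<n} \<times> {..<n}. \<bar>g $$ (i, j) - (if i = j then 1 else 0)\<bar>) < 2 * \<delta> \<and>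
                  C2_norm d (n - d) (\<lambda>x j. \<phi> x j - \<phi>g x j) \<le> real n * 4096 ^ n * 900 * \<epsilon> \<and>
                  real (card ((\<lambda>v. g *\<^sub>v v) ` graph_manifold d (n - d) \<phi>g
                              \<inter> scaled_primitive_vecs Q n))
                    \<ge> 1 / 8 * (1 / 512) ^ n * \<delta> ^ (n\<^sup>2 - 1) * \<epsilon> ^ (n - d)
                        * Q powr (real (d * n) / real (d + 2 * (n - d))))))))"
  proof (rule exI[of _ e], intro conjI allI impI)
    show "e > 0" using \<delta> by (simp add: e_def)
    fix \<epsilon> :: real assume \<epsilon>: "0 < \<epsilon> \<and> \<epsilon> < e"
    have \<epsilon>1: "0 < \<epsilon>" "\<epsilon> < 1" using \<epsilon> by (auto simp: e_def)
    have \<epsilon>2: "2 * \<epsilon> * (256 / \<delta>) ^ n \<le> (1 / 128) ^ n"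
    proof -
      have "\<epsilon> \<le> (1 / 128) ^ n / (2 * (256 / \<delta>) ^ n)" using \<epsilon> by (simp add: e_def)
      then have "\<epsilon> * (2 * (256 / \<delta>) ^ n) \<le> (1 / 128) ^ n"
        using \<delta> by (subst (asm) pos_le_divide_eq) auto
      then show ?thesis by (simp add: mult_ac)
    qed
    define p where "p d = real n / real (d + 2 * (n - d))" for d
    define ok where "ok d Q \<longleftrightarrow> 2 \<le> Q \<and> \<epsilon> * Q powr (1 - 2 * p d) \<le> 1 / 4 \<and> 2 \<le> \<epsilon> * Q powr (1 - p d) \<and>
      1536 + 384 * ln Q \<le> \<delta> * (Q powr (1 - p d) / 2)" for d Q
    have "\<forall>\<^sub>F Q in at_top. \<forall>d\<in>{1..n - 1}. ok d Q"
    proof (rule eventually_ball_finite, simp, rule ballI)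
      fix d assume d: "d \<in> {1..n - 1}"
      have s: "1 - p d > 0" "2 * p d - 1 > 0" using d by (auto simp: p_def field_simps of_nat_diff)
      show "\<forall>\<^sub>F Q in at_top. ok d Q"
        unfolding ok_def using eventually_large[OF s conjunct1[OF \<delta>] \<epsilon>1(1)] by simp
    qed
    then obtain N where N: "\<And>Q d. N \<le> Q \<Longrightarrow> d \<in> {1..n - 1} \<Longrightarrow> ok d Q"
      unfolding eventually_at_top_linorder by blast
    show "\<exists>Q0::real. Q0 > 0 \<and>
            (\<forall>d::nat. 1 \<le> d \<and> d \<le> n - 1 \<longrightarrow>
              (\<forall>\<phi> \<in> C2_maps d (n - d). \<forall>Q::real. Q \<ge> Q0 \<longrightarrow>
                (\<exists>g \<in> special_linear n. \<exists>\<phi>g \<in> C2_maps d (n - d).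
                  (MAX (i, j)\<in>{..<n} \<times> {..<n}. \<bar>g $$ (i, j) - (if i = j then 1 else 0)\<bar>) < 2 * \<delta> \<and>
                  C2_norm d (n - d) (\<lambda>x j. \<phi> x j - \<phi>g x j) \<le> real n * 4096 ^ n * 900 * \<epsilon> \<and>
                  real (card ((\<lambda>v. g *\<^sub>v v) ` graph_manifold d (n - d) \<phi>g
                              \<inter> scaled_primitive_vecs Q n))
                    \<ge> 1 / 8 * (1 / 512) ^ n * \<delta> ^ (n\<^sup>2 - 1) * \<epsilon> ^ (n - d)
                        * Q powr (real (d * n) / real (d + 2 * (n - d))))))"
    proof (rule exI[of _ "max 1 N"], intro conjI allI impI ballI)
      fix d \<phi> Q assume d: "1 \<le> d \<and> d \<le> n - 1" and \<phi>: "\<phi> \<in> C2_maps d (n - d)" and Q: "max 1 N \<le> Q"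
      have "ok d Q" using N[of Q d] Q d by simp
      then have Q': "2 \<le> Q" "\<epsilon> * Q powr (1 - 2 * p d) \<le> 1 / 4" "2 \<le> \<epsilon> * Q powr (1 - p d)"
        "1536 + 384 * ln Q \<le> \<delta> * (Q powr (1 - p d) / 2)" unfolding ok_def by auto
      from many_points[OF conjunct1[OF d] conjunct2[OF d] conjunct1[OF \<delta>] conjunct2[OF \<delta>] \<epsilon>1 \<epsilon>2 Q'[unfolded p_def] \<phi>]
      obtain g \<psi> where g: "g \<in> special_linear n" "\<psi> \<in> C2_maps d (n - d)"
        "(MAX (i, j)\<in>{..<n} \<times> {..<n}. \<bar>g $$ (i, j) - (if i = j then 1 else 0)\<bar>) < 2 * \<delta>"
        "C2_norm d (n - d) (\<lambda>x j. \<phi> x j - \<psi> x j) \<le> real n * 4096 ^ n * 900 * \<epsilon>"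
        "1 / 8 * (1 / 512) ^ n * \<epsilon> ^ (n - d) * Q powr (real (d * n) / real (d + 2 * (n - d))) \<le>
           real (card ((\<lambda>v. g *\<^sub>v v) ` graph_manifold d (n - d) \<psi> \<inter> scaled_primitive_vecs Q n))"
        by blast
      have "1 / 8 * (1 / 512) ^ n * \<delta> ^ (n\<^sup>2 - 1) * \<epsilon> ^ (n - d) * Q powr (real (d * n) / real (d + 2 * (n - d)))
        = \<delta> ^ (n\<^sup>2 - 1) * (1 / 8 * (1 / 512) ^ n * \<epsilon> ^ (n - d) * Q powr (real (d * n) / real (d + 2 * (n - d))))"
        by (simp only: mult_ac)
      also have "\<dots> \<le> 1 * (1 / 8 * (1 / 512) ^ n * \<epsilon> ^ (n - d) * Q powr (real (d * n) / real (d + 2 * (n - d))))"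
        using \<delta> \<epsilon>1 by (intro mult_right_mono power_le_one) auto
      also have "\<dots> \<le> real (card ((\<lambda>v. g *\<^sub>v v) ` graph_manifold d (n - d) \<psi> \<inter> scaled_primitive_vecs Q n))"
        using g(5) by simp
      finally show "\<exists>g \<in> special_linear n. \<exists>\<phi>g \<in> C2_maps d (n - d).
                  (MAX (i, j)\<in>{..<n} \<times> {..<n}. \<bar>g $$ (i, j) - (if i = j then 1 else 0)\<bar>) < 2 * \<delta> \<and>
                  C2_norm d (n - d) (\<lambda>x j. \<phi> x j - \<phi>g x j) \<le> real n * 4096 ^ n * 900 * \<epsilon> \<and>
                  real (card ((\<lambda>v. g *\<^sub>v v) ` graph_manifold d (n - d) \<phi>g
                              \<inter> scaled_primitive_vecs Q n))
                    \<ge> 1 / 8 * (1 / 512) ^ n * \<delta> ^ (n\<^sup>2 - 1) * \<epsilon> ^ (n - d)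
                        * Q powr (real (d * n) / real (d + 2 * (n - d)))"
        using g(1-4) by blast
    qed simp
  qed
qed (use assms in auto)

end
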